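(* Let $(X^\delta,Y^\delta)_{\delta\in\Delta}$ be a family of pairs of closed, non-zero subspaces $X^\delta\subset X$, $Y^\delta\subset Y$, and for each $\delta\in\Delta$ let $K_Y^\delta:(Y^\delta)'\to Y^\delta$ be a symmetric boundedly invertible linear map such that, for constants $0<r_\Delta\le R_\Delta<\infty$, $r_\Delta(A_sv)(v)\le((K_Y^\delta)^{-1}v)(v)\le R_\Delta(A_sv)(v)$ for all $\delta\in\Delta$, $v\in Y^\delta$. Let $Q_B^\delta\in\mathcal L(Y,Y)$ be such that $\operatorname{ran}Q_B^\delta\subset Y^\delta$ and $(\mathrm{Id}-(Q_B^\delta)')BX^\delta=0$. Let $\beta\ge1$, $g\in Y'$, $u_0\in H$, let $u\in X$ be the solution of $Bu=g$, $\gamma_0u=u_0$, and set $e^\delta_{\rm osc}(g):=\|(\mathrm{Id}-(Q_B^\delta)')g\|_{Y'}$. Then for all $w\in X^\delta$, $$r_\Delta\|(g-Bw)|_{Y^\delta}\|_{K_Y^\delta}^2+\beta\|u_0-\gamma_0w\|^2\le|\!|\!|u-w|\!|\!|_X^2\le\Big(\|Q_B^\delta\|_{\mathcal L(Y,Y)}\sqrt{R_\Delta}\,\|(g-Bw)|_{Y^\delta}\|_{K_Y^\delta}+e^\delta_{\rm osc}(g)\Big)^2+\beta\|u_0-\gamma_0w\|^2 .$$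
   Context: All spaces are over $\mathbb R$. $V,H$ are separable Hilbert spaces with $V\hookrightarrow H$ continuously and densely; $H$ is identified with its dual, giving the Gelfand triple $V\hookrightarrow H\simeq H'\hookrightarrow V'$. $\langle\cdot,\cdot\rangle$ denotes the scalar product on $H$ and its extension to the duality pairing on $V'\times V$; $\|\cdot\|$ is the norm of $H$. $I=(0,T)$. For a.e. $t\in I$, $a(t;\cdot,\cdot)$ is a bilinear form on $V\times V$, measurable in $t$ for each fixed pair of arguments, and, with constants independent of $t$, bounded, $|a(t;\eta,\zeta)|\lesssim\|\eta\|_V\|\zeta\|_V$, and coercive, $a(t;\eta,\eta)\gtrsim\|\eta\|_V^2$, for $\eta,\zeta\in V$. $X:=L_2(I;V)\cap H^1(I;V')$, $Y:=L_2(I;V)$. $\gamma_0:X\to H$, $u\mapsto u(0,\cdot)$, is the trace map. Operators: $A:Y\to Y'$, $(Aw)(v):=\int_I a(t;w(t),v(t))\,dt$; $A_s:=\frac12(A+A')$; $\partial_t:X\to Y'$, $(\partial_tw)(v):=\int_I\langle\frac{dw}{dt}(t),v(t)\rangle\,dt$; $B:=\partial_t+A:X\to Y'$. $(B,\gamma_0):X\to Y'\times H$ is boundedly invertible (known). $Y$ is equipped with $\|v\|_Y:=\sqrt{(A_sv)(v)}$, $Y'$ with the resulting dual norm, and $\|Q_B^\delta\|_{\mathcal L(Y,Y)}$ is the operator norm with respect to $\|\cdot\|_Y$. The energy-norm on $X$ is $|\!|\!|w|\!|\!|_X:=\sqrt{\|Bw\|_{Y'}^2+\beta\|\gamma_0w\|^2}$.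 For $f\in Y'$, $f|_{Y^\delta}\in(Y^\delta)'$ is its restriction; $\|f\|_{K_Y^\delta}:=\sqrt{f(K_Y^\delta f)}$ for $f\in(Y^\delta)'$. Symmetry of $K_Y^\delta$ means $f(K_Y^\delta h)=h(K_Y^\delta f)$ for $f,h\in(Y^\delta)'$. $(Q_B^\delta)':Y'\to Y'$ is the adjoint, $((Q_B^\delta)'f)(v)=f(Q_B^\delta v)$. *)

theory Defs
  imports "HOL-Analysis.Analysis"
begin

text \<open>
  The elements of the Bochner spaces are represented by functions on the real line, considered on
  the interval \<open>(0,T)\<close> only, and identified when they agree almost everywhere there. Norms on these
  spaces are therefore seminorms on functions, and identities between elements of a function space
  are understood almost everywhere. Functionals, and elements of \<open>V\<close>, \<open>V'\<close> and \<open>H\<close>, are compared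
  by genuine equality.

  \<open>V\<close> and \<open>H\<close> are types, \<open>j\<close> is the embedding of \<open>V\<close> in \<open>H\<close>, and \<open>V'\<close> is
  \<open>'v \<Rightarrow>\<^sub>L real\<close>.
\<close>

abbreviation time_measure :: "real \<Rightarrow> real measure" where
  "time_measure T \<equiv> lebesgue_on {0<..<T}"

definition gelfand_embedding :: "('v::real_inner \<Rightarrow> 'h::real_inner) \<Rightarrow> bool" where
  "gelfand_embedding j \<longleftrightarrow> bounded_linear j \<and> inj j \<and> closure (range j) = UNIV"

text \<open>The embedding \<open>H \<simeq> H' \<hookrightarrow> V'\<close>.\<close>

definition H_to_dual :: "('v::real_inner \<Rightarrow> 'h::real_inner) \<Rightarrow> 'h \<Rightarrow> ('v \<Rightarrow>\<^sub>L real)" where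
  "H_to_dual j h = Blinfun (\<lambda>v. h \<bullet> j v)"

definition admissible_form ::
    "real \<Rightarrow> (real \<Rightarrow> 'v::real_inner \<Rightarrow> 'v \<Rightarrow> real) \<Rightarrow> bool" where
  "admissible_form T a \<longleftrightarrow>
     (AE t in time_measure T. bilinear (a t)) \<and>
     (\<forall>\<eta> \<zeta>. (\<lambda>t. a t \<eta> \<zeta>) \<in> borel_measurable (time_measure T)) \<and>
     (\<exists>C. AE t in time_measure T. \<forall>\<eta> \<zeta>. \<bar>a t \<eta> \<zeta>\<bar> \<le> C * norm \<eta> * norm \<zeta>) \<and>
     (\<exists>c>0. AE t in time_measure T. \<forall>\<eta>. a t \<eta> \<eta> \<ge> c * (norm \<eta>)\<^sup>2)"


subsection \<open>Bochner and Sobolev spaces\<close>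

text \<open>Borel measurability is strong measurability here: \<open>L2\<close> is only used for values in the
  separable spaces \<open>V\<close> and \<open>V'\<close>.\<close>

definition L2 :: "real \<Rightarrow> (real \<Rightarrow> 'b::real_normed_vector) set" where
  "L2 T = {f. f \<in> borel_measurable (time_measure T) \<and>
              integrable (time_measure T) (\<lambda>t. (norm (f t))\<^sup>2)}"

definition L2_norm :: "real \<Rightarrow> (real \<Rightarrow> 'b::real_normed_vector) \<Rightarrow> real" where
  "L2_norm T f = sqrt (LINT t|time_measure T. (norm (f t))\<^sup>2)"

definition test_functions :: "real \<Rightarrow> (real \<Rightarrow> real) set" where
  "test_functions T = {\<phi>. (\<forall>k. (deriv ^^ k) \<phi> differentiable_on UNIV) \<and>
                          closure {t. \<phi> t \<noteq> 0} \<subseteq> {0<..<T}}"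

text \<open>The identity \<open>\<integral> \<phi>' f = - \<integral> \<phi> g\<close> of Bochner integrals in \<open>V'\<close>, evaluated at each
  element of \<open>V\<close>.\<close>

definition has_weak_derivative ::
    "real \<Rightarrow> (real \<Rightarrow> ('v::real_normed_vector \<Rightarrow>\<^sub>L real)) \<Rightarrow> (real \<Rightarrow> ('v \<Rightarrow>\<^sub>L real)) \<Rightarrow> bool" where
  "has_weak_derivative T f g \<longleftrightarrow>
     (\<forall>\<phi>\<in>test_functions T. \<forall>v.
        (LINT t|time_measure T. deriv \<phi> t * blinfun_apply (f t) v) =
        - (LINT t|time_measure T. \<phi> t * blinfun_apply (g t) v))"

definition H1 :: "real \<Rightarrow> (real \<Rightarrow> ('v::real_normed_vector \<Rightarrow>\<^sub>L real)) set" where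
  "H1 T = {f \<in> L2 T. \<exists>g\<in>L2 T. has_weak_derivative T f g}"

definition weak_deriv ::
    "real \<Rightarrow> (real \<Rightarrow> ('v::real_normed_vector \<Rightarrow>\<^sub>L real)) \<Rightarrow> real \<Rightarrow> ('v \<Rightarrow>\<^sub>L real)" where
  "weak_deriv T f = (SOME g. g \<in> L2 T \<and> has_weak_derivative T f g)"

definition H1_norm :: "real \<Rightarrow> (real \<Rightarrow> ('v::real_normed_vector \<Rightarrow>\<^sub>L real)) \<Rightarrow> real" where
  "H1_norm T f = sqrt ((L2_norm T f)\<^sup>2 + (L2_norm T (weak_deriv T f))\<^sup>2)"

definition Yspace :: "real \<Rightarrow> (real \<Rightarrow> 'v::real_inner) set" where
  "Yspace T = L2 T"

definition Xspace ::
    "real \<Rightarrow> ('v::real_inner \<Rightarrow> 'h::real_inner) \<Rightarrow> (real \<Rightarrow> 'v) set" where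
  "Xspace T j = {w \<in> L2 T. (\<lambda>t. H_to_dual j (j (w t))) \<in> H1 T}"

definition Xnorm ::
    "real \<Rightarrow> ('v::real_inner \<Rightarrow> 'h::real_inner) \<Rightarrow> (real \<Rightarrow> 'v) \<Rightarrow> real" where
  "Xnorm T j w = sqrt ((L2_norm T w)\<^sup>2 + (H1_norm T (\<lambda>t. H_to_dual j (j (w t))))\<^sup>2)"

text \<open>Since \<open>X\<close> embeds in \<open>C([0,T];H)\<close>, every element of \<open>X\<close> has exactly one representative \<open>c\<close> as
  below, so that these conditions determine \<open>\<gamma>0\<close> on \<open>X\<close>.\<close>

definition trace_map ::
    "real \<Rightarrow> ('v::real_inner \<Rightarrow> 'h::real_inner) \<Rightarrow> ((real \<Rightarrow> 'v) \<Rightarrow> 'h) \<Rightarrow> bool" where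
  "trace_map T j \<gamma>0 \<longleftrightarrow>
     (\<forall>u\<in>Xspace T j. \<forall>w\<in>Xspace T j. \<gamma>0 (\<lambda>t. u t + w t) = \<gamma>0 u + \<gamma>0 w) \<and>
     (\<forall>s. \<forall>w\<in>Xspace T j. \<gamma>0 (\<lambda>t. s *\<^sub>R w t) = s *\<^sub>R \<gamma>0 w) \<and>
     (\<forall>w\<in>Xspace T j. \<forall>c. continuous_on {0..T} c \<and> (AE t in time_measure T. c t = j (w t))
        \<longrightarrow> \<gamma>0 w = c 0)"


subsection \<open>Subspaces, functionals and operators\<close>

definition closed_subspace ::
    "(real \<Rightarrow> 'v::real_vector) set \<Rightarrow> ((real \<Rightarrow> 'v) \<Rightarrow> real) \<Rightarrow> (real \<Rightarrow> 'v) set \<Rightarrow> bool" where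
  "closed_subspace W n S \<longleftrightarrow>
     S \<subseteq> W \<and> (\<lambda>t. 0) \<in> S \<and>
     (\<forall>u\<in>S. \<forall>v\<in>S. (\<lambda>t. u t + v t) \<in> S) \<and>
     (\<forall>s. \<forall>v\<in>S. (\<lambda>t. s *\<^sub>R v t) \<in> S) \<and>
     (\<forall>vs. \<forall>v\<in>W. (\<forall>k::nat. vs k \<in> S) \<and> (\<lambda>k. n (\<lambda>t. vs k t - v t)) \<longlonglongrightarrow> 0 \<longrightarrow> v \<in> S)"

definition nonzero_space :: "real \<Rightarrow> (real \<Rightarrow> 'v::real_vector) set \<Rightarrow> bool" where
  "nonzero_space T S \<longleftrightarrow> (\<exists>v\<in>S. \<not> (AE t in time_measure T. v t = 0))"

text \<open>Functionals are extensional: two elements of the dual of \<open>S\<close> that agree on \<open>S\<close> are equal, and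
  \<open>restrict f S\<close> is the restriction of \<open>f\<close> as an element of that dual.\<close>

definition dual_space ::
    "(real \<Rightarrow> 'v::real_vector) set \<Rightarrow> ((real \<Rightarrow> 'v) \<Rightarrow> real) \<Rightarrow> ((real \<Rightarrow> 'v) \<Rightarrow> real) set" where
  "dual_space S n = {f \<in> extensional S.
     (\<forall>u\<in>S. \<forall>v\<in>S. f (\<lambda>t. u t + v t) = f u + f v) \<and>
     (\<forall>s. \<forall>v\<in>S. f (\<lambda>t. s *\<^sub>R v t) = s * f v) \<and>
     (\<exists>C. \<forall>v\<in>S. \<bar>f v\<bar> \<le> C * n v)}"

definition dual_norm ::
    "(real \<Rightarrow> 'v::real_vector) set \<Rightarrow> ((real \<Rightarrow> 'v) \<Rightarrow> real) \<Rightarrow> ((real \<Rightarrow> 'v) \<Rightarrow> real) \<Rightarrow> real" where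
  "dual_norm S n f = (SUP v\<in>{v\<in>S. n v \<le> 1}. \<bar>f v\<bar>)"

definition functional_diff ::
    "(real \<Rightarrow> 'v) set \<Rightarrow> ((real \<Rightarrow> 'v) \<Rightarrow> real) \<Rightarrow> ((real \<Rightarrow> 'v) \<Rightarrow> real) \<Rightarrow> (real \<Rightarrow> 'v) \<Rightarrow> real" where
  "functional_diff S f h = (\<lambda>v\<in>S. f v - h v)"

definition bounded_operator ::
    "real \<Rightarrow> (real \<Rightarrow> 'v::real_vector) set \<Rightarrow> ((real \<Rightarrow> 'v) \<Rightarrow> real) \<Rightarrow>
     ((real \<Rightarrow> 'v) \<Rightarrow> (real \<Rightarrow> 'v)) \<Rightarrow> bool" where
  "bounded_operator T S n Q \<longleftrightarrow>
     Q ` S \<subseteq> S \<and>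
     (\<forall>u\<in>S. \<forall>v\<in>S. AE t in time_measure T. Q (\<lambda>s. u s + v s) t = Q u t + Q v t) \<and>
     (\<forall>c. \<forall>v\<in>S. AE t in time_measure T. Q (\<lambda>s. c *\<^sub>R v s) t = c *\<^sub>R Q v t) \<and>
     (\<exists>C. \<forall>v\<in>S. n (Q v) \<le> C * n v)"

definition operator_norm ::
    "(real \<Rightarrow> 'v::real_vector) set \<Rightarrow> ((real \<Rightarrow> 'v) \<Rightarrow> real) \<Rightarrow>
     ((real \<Rightarrow> 'v) \<Rightarrow> (real \<Rightarrow> 'v)) \<Rightarrow> real" where
  "operator_norm S n Q = (SUP v\<in>{v\<in>S. n v \<le> 1}. n (Q v))"

definition adjoint_op ::
    "(real \<Rightarrow> 'v) set \<Rightarrow> ((real \<Rightarrow> 'v) \<Rightarrow> (real \<Rightarrow> 'v)) \<Rightarrow>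
     ((real \<Rightarrow> 'v) \<Rightarrow> real) \<Rightarrow> (real \<Rightarrow> 'v) \<Rightarrow> real" where
  "adjoint_op S Q f = (\<lambda>v\<in>S. f (Q v))"

definition dual_op_inverse ::
    "real \<Rightarrow> (real \<Rightarrow> 'v::real_vector) set \<Rightarrow> ((real \<Rightarrow> 'v) \<Rightarrow> real) \<Rightarrow>
     (((real \<Rightarrow> 'v) \<Rightarrow> real) \<Rightarrow> (real \<Rightarrow> 'v)) \<Rightarrow> (real \<Rightarrow> 'v) \<Rightarrow> ((real \<Rightarrow> 'v) \<Rightarrow> real)" where
  "dual_op_inverse T S n K v =
     (THE f. f \<in> dual_space S n \<and> (AE t in time_measure T. K f t = v t))"

definition boundedly_invertible_dual_op ::
    "real \<Rightarrow> (real \<Rightarrow> 'v::real_vector) set \<Rightarrow> ((real \<Rightarrow> 'v) \<Rightarrow> real) \<Rightarrow>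
     (((real \<Rightarrow> 'v) \<Rightarrow> real) \<Rightarrow> (real \<Rightarrow> 'v)) \<Rightarrow> bool" where
  "boundedly_invertible_dual_op T S n K \<longleftrightarrow>
     K ` dual_space S n \<subseteq> S \<and>
     (\<forall>f\<in>dual_space S n. \<forall>h\<in>dual_space S n. AE t in time_measure T.
        K (\<lambda>v\<in>S. f v + h v) t = K f t + K h t) \<and>
     (\<forall>c. \<forall>f\<in>dual_space S n. AE t in time_measure T. K (\<lambda>v\<in>S. c * f v) t = c *\<^sub>R K f t) \<and>
     (\<exists>C. \<forall>f\<in>dual_space S n. n (K f) \<le> C * dual_norm S n f) \<and>
     (\<forall>v\<in>S. \<exists>!f. f \<in> dual_space S n \<and> (AE t in time_measure T. K f t = v t)) \<and>
     (\<exists>C. \<forall>v\<in>S. dual_norm S n (dual_op_inverse T S n K v) \<le> C * n v)"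

definition symmetric_dual_op ::
    "(real \<Rightarrow> 'v::real_vector) set \<Rightarrow> ((real \<Rightarrow> 'v) \<Rightarrow> real) \<Rightarrow>
     (((real \<Rightarrow> 'v) \<Rightarrow> real) \<Rightarrow> (real \<Rightarrow> 'v)) \<Rightarrow> bool" where
  "symmetric_dual_op S n K \<longleftrightarrow>
     (\<forall>f\<in>dual_space S n. \<forall>h\<in>dual_space S n. f (K h) = h (K f))"

definition K_norm ::
    "(((real \<Rightarrow> 'v) \<Rightarrow> real) \<Rightarrow> (real \<Rightarrow> 'v)) \<Rightarrow> ((real \<Rightarrow> 'v) \<Rightarrow> real) \<Rightarrow> real" where
  "K_norm K f = sqrt (f (K f))"


subsection \<open>The parabolic operator and the energy norms\<close>

definition Aop ::
    "real \<Rightarrow> (real \<Rightarrow> 'v::real_inner \<Rightarrow> 'v \<Rightarrow> real) \<Rightarrow> (real \<Rightarrow> 'v) \<Rightarrow> (real \<Rightarrow> 'v) \<Rightarrow> real" where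
  "Aop T a w = (\<lambda>v\<in>Yspace T. LINT t|time_measure T. a t (w t) (v t))"

definition Aop_adj ::
    "real \<Rightarrow> (real \<Rightarrow> 'v::real_inner \<Rightarrow> 'v \<Rightarrow> real) \<Rightarrow> (real \<Rightarrow> 'v) \<Rightarrow> (real \<Rightarrow> 'v) \<Rightarrow> real" where
  "Aop_adj T a w = (\<lambda>v\<in>Yspace T. Aop T a v w)"

definition Asym ::
    "real \<Rightarrow> (real \<Rightarrow> 'v::real_inner \<Rightarrow> 'v \<Rightarrow> real) \<Rightarrow> (real \<Rightarrow> 'v) \<Rightarrow> (real \<Rightarrow> 'v) \<Rightarrow> real" where
  "Asym T a w = (\<lambda>v\<in>Yspace T. (1/2) * (Aop T a w v + Aop_adj T a w v))"

definition Ynorm ::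
    "real \<Rightarrow> (real \<Rightarrow> 'v::real_inner \<Rightarrow> 'v \<Rightarrow> real) \<Rightarrow> (real \<Rightarrow> 'v) \<Rightarrow> real" where
  "Ynorm T a v = sqrt (Asym T a v v)"

definition dt_op ::
    "real \<Rightarrow> ('v::real_inner \<Rightarrow> 'h::real_inner) \<Rightarrow> (real \<Rightarrow> 'v) \<Rightarrow> (real \<Rightarrow> 'v) \<Rightarrow> real" where
  "dt_op T j w = (\<lambda>v\<in>Yspace T. LINT t|time_measure T.
     blinfun_apply (weak_deriv T (\<lambda>s. H_to_dual j (j (w s))) t) (v t))"

definition Bop ::
    "real \<Rightarrow> ('v::real_inner \<Rightarrow> 'h::real_inner) \<Rightarrow> (real \<Rightarrow> 'v \<Rightarrow> 'v \<Rightarrow> real) \<Rightarrow>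
     (real \<Rightarrow> 'v) \<Rightarrow> (real \<Rightarrow> 'v) \<Rightarrow> real" where
  "Bop T j a w = (\<lambda>v\<in>Yspace T. dt_op T j w v + Aop T a w v)"

abbreviation Ydual ::
    "real \<Rightarrow> (real \<Rightarrow> 'v::real_inner \<Rightarrow> 'v \<Rightarrow> real) \<Rightarrow> ((real \<Rightarrow> 'v) \<Rightarrow> real) set" where
  "Ydual T a \<equiv> dual_space (Yspace T) (Ynorm T a)"

abbreviation Ydual_norm ::
    "real \<Rightarrow> (real \<Rightarrow> 'v::real_inner \<Rightarrow> 'v \<Rightarrow> real) \<Rightarrow> ((real \<Rightarrow> 'v) \<Rightarrow> real) \<Rightarrow> real" where
  "Ydual_norm T a \<equiv> dual_norm (Yspace T) (Ynorm T a)"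

definition Xenergy_norm ::
    "real \<Rightarrow> ('v::real_inner \<Rightarrow> 'h::real_inner) \<Rightarrow> (real \<Rightarrow> 'v \<Rightarrow> 'v \<Rightarrow> real) \<Rightarrow>
     ((real \<Rightarrow> 'v) \<Rightarrow> 'h) \<Rightarrow> real \<Rightarrow> (real \<Rightarrow> 'v) \<Rightarrow> real" where
  "Xenergy_norm T j a \<gamma>0 \<beta> w =
     sqrt ((Ydual_norm T a (Bop T j a w))\<^sup>2 + \<beta> * (norm (\<gamma>0 w))\<^sup>2)"

definition osc_error ::
    "real \<Rightarrow> (real \<Rightarrow> 'v::real_inner \<Rightarrow> 'v \<Rightarrow> real) \<Rightarrow> ((real \<Rightarrow> 'v) \<Rightarrow> (real \<Rightarrow> 'v)) \<Rightarrow>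
     ((real \<Rightarrow> 'v) \<Rightarrow> real) \<Rightarrow> real" where
  "osc_error T a Q g =
     Ydual_norm T a (functional_diff (Yspace T) g (adjoint_op (Yspace T) Q g))"

end

(*
  With f = g - Bw = B(u - w), the squared energy norm is the squared dual norm of f plus the trace
  term.  The inverse of K_Y is a scalar product on Y_delta equivalent to that of A_s, so Riesz duality
  makes the K_Y-norm of the restriction of f comparable to its dual norm there, which gives the lower
  bound.  For the upper bound split f v = (f - Q'f) v + f (Q v): the first term is (g - Q'g) v since
  Q' fixes BX_delta, and the second only sees the restriction of f.

  That B(u - w) = Bu - Bw is not immediate, because the weak derivative is a choice: it rests on
  uniqueness of weak derivatives, tested with exp (-c/(x-a)) exp (-c/(b-x)) as c tends to 0, and on
  the Riesz representation, which reduces measurability questions in V' to V.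
*)
theory Submission
  imports Defs
begin

subsection \<open>Smooth approximations of indicators of intervals\<close>

text \<open>Elements of the function spaces are identified almost everywhere, functionals are
  compared exactly, and \<open>K\<close> and \<open>Q\<close> are linear only up to null sets. The
  bridge is that a functional bounded by a seminorm that ignores null sets cannot separate functions
  agreeing almost everywhere, so each such identity becomes exact once a functional is applied to
  it. On Y_delta no representer is obtained by minimisation. Riesz duality takes the form of the
  Cauchy-Schwarz inequality for (f, h) -> f (K h) on the dual: any z in Y_delta is K h for its
  preimage h, so f z is a value of that form. Testing f with its own image K f brings in r, and
  bounding h z for the preimage h brings in R; hence r in the lower estimate and sqrt R in the upper
  one.\<close>

definition flat :: "real poly \<Rightarrow> real \<Rightarrow> real \<Rightarrow> real" where
  "flat p c y = (if 0 < y then poly p (1 / y) * exp (- (c / y)) else 0)"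

lemma poly_times_exp_tendsto_0:
  fixes p :: "real poly"
  assumes "0 < c"
  shows "((\<lambda>z. poly p z * exp (- (c * z))) \<longlongrightarrow> 0) at_top"
proof -
  have mon: "((\<lambda>z. z ^ k * exp (- (c * z))) \<longlongrightarrow> 0) at_top" for k
  proof -
    have "filterlim (\<lambda>z. c * z) at_top at_top"
      using assms by (simp add: filterlim_tendsto_pos_mult_at_top[OF tendsto_const _ filterlim_ident])
    from filterlim_compose[OF tendsto_power_div_exp_0 this]
    have "((\<lambda>z. (c * z) ^ k / exp (c * z)) \<longlongrightarrow> 0) at_top" .
    from tendsto_mult[OF tendsto_const[of "1 / c ^ k"] this]
    show ?thesis
      using assms by (simp add: power_mult_distrib exp_minus field_simps)
  qed
  have "((\<lambda>z. \<Sum>i\<le>degree p. coeff p i * (z ^ i * exp (- (c * z)))) \<longlongrightarrow> (\<Sum>i\<le>degree p. coeff p i * 0)) at_top"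
    by (intro tendsto_sum tendsto_mult tendsto_const mon)
  then show ?thesis
    by (simp add: poly_altdef sum_distrib_right mult.assoc)
qed

text \<open>With z = 1/y the chain rule contributes the factor z^2 and turns p into c p - p', so
  polynomial multiples of exp (-c/y) are closed under differentiation. Only y = 0 needs a limit:
  dividing by h multiplies the polynomial by one more factor 1/h, which the exponential still
  beats.\<close>

lemma has_real_derivative_flat:
  assumes "0 < c"
  shows "(flat p c has_real_derivative flat ([:0, 0, 1:] * (smult c p - pderiv p)) c y) (at y)"
proof (cases y "0 :: real" rule: linorder_cases)
  case less
  have "((\<lambda>y. 0) has_real_derivative 0) (at y)"
    by simp
  then have "(flat p c has_real_derivative 0) (at y)"
    by (rule DERIV_cong_ev[THEN iffD1, rotated -1])
       (use less in \<open>auto simp: flat_def intro!: eventually_mono[OF order_tendstoD(2)[OF tendsto_ident_at less]]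
          eventually_nhds_in_open[THEN eventually_mono, of "{..<0}"]\<close>)
  then show ?thesis
    using less by (simp add: flat_def)
next
  case greater
  have "((\<lambda>y. poly p (1 / y) * exp (- (c / y))) has_real_derivative
     flat ([:0, 0, 1:] * (smult c p - pderiv p)) c y) (at y)"
    using greater
    by (auto intro!: derivative_eq_intros simp: flat_def)
       (simp add: field_simps power2_eq_square)
  then show ?thesis
    by (rule DERIV_cong_ev[THEN iffD1, rotated -1])
       (use greater in \<open>auto simp: flat_def intro!: eventually_nhds_in_open[THEN eventually_mono, of "{0<..}"]\<close>)
next
  case equal
  have "((\<lambda>h. flat p c h / h) \<longlongrightarrow> 0) (at 0)"
  proof (rule filterlim_split_at)
    show "((\<lambda>h. flat p c h / h) \<longlongrightarrow> 0) (at_left 0)"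
      by (rule tendsto_eventually) (auto simp: flat_def eventually_at_filter)
    have "((\<lambda>h. poly ([:0, 1:] * p) (inverse h) * exp (- (c * inverse h))) \<longlongrightarrow> 0) (at_right 0)"
      by (rule filterlim_compose[OF poly_times_exp_tendsto_0[OF assms] filterlim_inverse_at_top_right])
    then show "((\<lambda>h. flat p c h / h) \<longlongrightarrow> 0) (at_right 0)"
      by (rule Lim_transform_eventually)
         (auto simp: flat_def eventually_at_filter field_simps)
  qed
  then show ?thesis
    using equal by (simp add: DERIV_def flat_def)
qed

text \<open>A class of functions closed under differentiation, so that derivatives of all orders are
  handled by one induction on the order. Scalars are absorbed by the polynomials, and sums are
  needed because of the product rule.\<close>

inductive_set bump_span :: "real \<Rightarrow> real \<Rightarrow> real \<Rightarrow> (real \<Rightarrow> real) set" for c a b where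
  product: "(\<lambda>x. flat p c (x - a) * flat q c (b - x)) \<in> bump_span c a b"
| add: "f \<in> bump_span c a b \<Longrightarrow> g \<in> bump_span c a b \<Longrightarrow> (\<lambda>x. f x + g x) \<in> bump_span c a b"

lemma bump_span_deriv:
  assumes "0 < c" "f \<in> bump_span c a b"
  shows "\<exists>g\<in>bump_span c a b. \<forall>x. (f has_real_derivative g x) (at x)"
  using assms(2)
proof induction
  case (product p q)
  define D where "D p = [:0, 0, 1:] * (smult c p - pderiv p)" for p
  have left: "((\<lambda>x. flat p c (x - a)) has_real_derivative flat (D p) c (x - a)) (at x)" for x p
  proof -
    have "((\<lambda>x. x - a) has_real_derivative 1) (at x)"
      by (auto intro!: derivative_eq_intros)
    from DERIV_chain'[OF this has_real_derivative_flat[OF assms(1)]] show ?thesis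
      by (simp add: D_def)
  qed
  \<comment> \<open>The reflected argument has inner derivative -1; this sign moves into the
    polynomial to stay within products of two \<open>flat\<close> functions.\<close>
  have right: "((\<lambda>x. flat q c (b - x)) has_real_derivative flat (- D q) c (b - x)) (at x)" for x q
  proof -
    have "((\<lambda>x. b - x) has_real_derivative - 1) (at x)"
      by (auto intro!: derivative_eq_intros)
    from DERIV_chain'[OF this has_real_derivative_flat[OF assms(1), of q]]
    have "((\<lambda>x. flat q c (b - x)) has_real_derivative - flat (D q) c (b - x)) (at x)"
      by (simp add: D_def)
    also have "- flat (D q) c (b - x) = flat (- D q) c (b - x)"
      by (simp add: flat_def)
    finally show ?thesis .
  qed
  have "((\<lambda>x. flat p c (x - a) * flat q c (b - x)) has_real_derivative
    (flat (D p) c (x - a) * flat q c (b - x) + flat p c (x - a) * flat (- D q) c (b - x))) (at x)" for x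
    by (rule derivative_eq_intros left right refl)+ simp
  then show ?case
    by (intro bexI[of _ "\<lambda>x. flat (D p) c (x - a) * flat q c (b - x) + flat p c (x - a) * flat (- D q) c (b - x)"]
        bump_span.intros allI)
next
  case (add f g)
  then obtain f' g' where "f' \<in> bump_span c a b" "g' \<in> bump_span c a b"
    "\<forall>x. (f has_real_derivative f' x) (at x)" "\<forall>x. (g has_real_derivative g' x) (at x)"
    by auto
  then show ?case
    by (intro bexI[of _ "\<lambda>x. f' x + g' x"] bump_span.intros allI DERIV_add) auto
qed

lemma bump_span_smooth:
  assumes "0 < c" "f \<in> bump_span c a b"
  shows "(deriv ^^ k) f \<in> bump_span c a b \<and> (deriv ^^ k) f differentiable_on UNIV"
proof -
  have deriv: "deriv g \<in> bump_span c a b \<and> g differentiable_on UNIV" if g: "g \<in> bump_span c a b" for g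
  proof -
    obtain g' where g': "g' \<in> bump_span c a b" "\<And>x. (g has_real_derivative g' x) (at x)"
      using bump_span_deriv[OF assms(1) g] by blast
    then have "deriv g = g'"
      by (auto simp: fun_eq_iff intro: DERIV_imp_deriv)
    moreover have "g differentiable_on UNIV"
      using g'(2) by (auto simp: differentiable_on_def real_differentiable_def)
    ultimately show ?thesis
      using g'(1) by simp
  qed
  have "(deriv ^^ k) f \<in> bump_span c a b"
    by (induction k) (use assms(2) deriv in auto)
  then show ?thesis
    using deriv by blast
qed

text \<open>The support lies in the closed interval [a, b], which keeps a distance from 0 and T. For
  b \<le> a the product vanishes identically, so intervals that degenerate after shrinking do no
  harm.\<close>

lemma bump_test_function:
  assumes "0 < c" "0 < a" "b < T"
  shows "(\<lambda>x. flat 1 c (x - a) * flat 1 c (b - x)) \<in> test_functions T"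
proof -
  have "closure {x. flat 1 c (x - a) * flat 1 c (b - x) \<noteq> 0} \<subseteq> {a..b}"
    by (rule closure_minimal) (auto simp: flat_def split: if_splits)
  also have "\<dots> \<subseteq> {0<..<T}"
    using assms by auto
  finally show ?thesis
    using bump_span_smooth[OF assms(1) bump_span.product[where p = 1 and q = 1]]
    by (simp add: test_functions_def)
qed

lemma flat_1_bounds: "0 < c \<Longrightarrow> 0 \<le> flat 1 c y \<and> flat 1 c y \<le> 1"
  by (simp add: flat_def)

text \<open>For y > 0 the exponent c n / (y - e n) tends to 0. The shifts are nonnegative, so a
  nonpositive y stays on the side where \<open>flat\<close> is zero, and the limit at y = 0 is 0 as
  for the open half-line.\<close>

lemma flat_1_tendsto_indicator:
  assumes "c \<longlonglongrightarrow> 0" "e \<longlonglongrightarrow> 0" "\<And>n. 0 \<le> e n"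
  shows "(\<lambda>n. flat 1 (c n) (y - e n)) \<longlonglongrightarrow> indicator {0<..} y"
proof (cases "0 < y")
  case True
  have lim: "(\<lambda>n. y - e n) \<longlonglongrightarrow> y"
    by (auto intro!: tendsto_eq_intros assms)
  have "(\<lambda>n. exp (- (c n / (y - e n)))) \<longlonglongrightarrow> exp (- (0 / y))"
    using True by (intro tendsto_intros lim assms) auto
  moreover have "\<forall>\<^sub>F n in sequentially. exp (- (c n / (y - e n))) = flat 1 (c n) (y - e n)"
    using order_tendstoD(1)[OF lim True] by eventually_elim (simp add: flat_def)
  ultimately show ?thesis
    using True by (auto intro: Lim_transform_eventually)
next
  case False
  then have "flat 1 (c n) (y - e n) = 0" for n
    using assms(3)[of n] by (simp add: flat_def)
  then show ?thesis
    using False by simp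
qed

lemma bump_tendsto_indicator:
  assumes "0 < T"
  obtains \<phi> :: "nat \<Rightarrow> real \<Rightarrow> real" where "\<And>n. \<phi> n \<in> test_functions T" "\<And>n x. \<bar>\<phi> n x\<bar> \<le> 1"
    "\<And>x. x \<in> {0<..<T} \<Longrightarrow> (\<lambda>n. \<phi> n x) \<longlonglongrightarrow> indicator {a<..<b} x"
proof
  define c :: "nat \<Rightarrow> real" where "c n = 1 / real (Suc n)" for n
  \<comment> \<open>\<open>c n\<close> has two tasks: as the parameter of the exponential it makes
    the bump steep, and as a margin it pulls the support inside (0,T), to which \<open>max\<close>
    and \<open>min\<close> clip the interval.\<close>
  define \<phi> where "\<phi> n x = flat 1 (c n) (x - (max a 0 + c n)) * flat 1 (c n) ((min b T - c n) - x)" for n x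
  have c: "c \<longlonglongrightarrow> 0" "0 < c n" for n
    using LIMSEQ_inverse_real_of_nat unfolding c_def[abs_def] by (auto simp: inverse_eq_divide)
  show "\<phi> n \<in> test_functions T" for n
    unfolding \<phi>_def using c(2)[of n] by (intro bump_test_function) auto
  show "\<bar>\<phi> n x\<bar> \<le> 1" for n x
    using flat_1_bounds[OF c(2)] by (auto simp: \<phi>_def abs_mult intro!: mult_le_one)
  fix x assume x: "x \<in> {0<..<T}"
  have "(\<lambda>n. flat 1 (c n) ((x - max a 0) - c n) * flat 1 (c n) ((min b T - x) - c n))
      \<longlonglongrightarrow> indicator {0<..} (x - max a 0) * indicator {0<..} (min b T - x)"
    by (intro tendsto_mult flat_1_tendsto_indicator c less_imp_le)
  also have "(\<lambda>n. flat 1 (c n) ((x - max a 0) - c n) * flat 1 (c n) ((min b T - x) - c n)) = (\<lambda>n. \<phi> n x)"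
    by (simp add: \<phi>_def algebra_simps)
  also have "indicator {0<..} (x - max a 0) * indicator {0<..} (min b T - x) = (indicator {a<..<b} x :: real)"
    using x by (auto simp: indicator_def)
  finally show "(\<lambda>n. \<phi> n x) \<longlonglongrightarrow> indicator {a<..<b} x" .
qed

section \<open>The fundamental lemma of the calculus of variations\<close>

lemma sigma_finite_lebesgue: "sigma_finite_measure (lebesgue :: real measure)"
proof -
  obtain A :: "real set set" where "countable A" "A \<subseteq> sets lborel" "\<Union>A = space lborel" "\<forall>a\<in>A. emeasure lborel a \<noteq> \<infinity>"
    using lborel.sigma_finite_countable by auto
  then show ?thesis
    by (intro sigma_finite_measure.intro exI[of _ A]) auto
qed

text \<open>Dynkin's argument: open intervals are an intersection-stable generator of the Borel
  sets, and the sets over which h integrates to 0 are stable under countable disjoint unions and, by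
  the last assumption, under complements. A Lebesgue set is a Borel set up to a null set, so h has
  integral 0 over each measurable set.\<close>

lemma AE_zero_if_interval_integrals_zero:
  fixes h :: "real \<Rightarrow> real"
  assumes h: "integrable lebesgue h"
    and zero: "\<And>a b. set_lebesgue_integral lebesgue {a<..<b} h = 0"
    and "set_lebesgue_integral lebesgue UNIV h = 0"
  shows "AE x in lebesgue. h x = 0"
proof (rule sigma_finite_measure.density_zero[OF sigma_finite_lebesgue h])
  have int: "set_integrable lebesgue A h" if "A \<in> sets lebesgue" for A
    using set_integrable_subset[of lebesgue UNIV h A] h that by (simp add: set_integrable_def)
  have borel: "set_lebesgue_integral lebesgue A h = 0" if "A \<in> sets borel" for A
  proof -
    define G where "G = range (\<lambda>(a, b). {a<..<b :: real})"
    have borel_G: "sets borel = sigma_sets UNIV G"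
      by (simp add: borel_eq_box G_def)
    have "Int_stable G" "G \<subseteq> Pow UNIV" "A \<in> sigma_sets UNIV G"
    proof -
      show "Int_stable G"
      proof (rule Int_stableI)
        fix A B assume "A \<in> G" "B \<in> G"
        then obtain a b c d where "A = {a<..<b}" "B = {c<..<d}"
          by (auto simp: G_def)
        then have "A \<inter> B = {max a c<..<min b d}"
          by auto
        then show "A \<inter> B \<in> G"
          by (auto simp: G_def)
      qed
      show "G \<subseteq> Pow UNIV" "A \<in> sigma_sets UNIV G"
        using that borel_G by auto
    qed
    then show ?thesis
    proof (induction rule: sigma_sets_induct_disjoint)
      case (basic A)
      then show ?case by (auto simp: G_def zero)
    next
      case empty
      then show ?case by (simp add: set_lebesgue_integral_def)
    next
      case (compl A)
      then have "A \<in> sets borel"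
        using borel_G by simp
      then have A: "A \<in> sets lebesgue"
        by auto
      have "set_lebesgue_integral lebesgue (A \<union> (UNIV - A)) h =
          set_lebesgue_integral lebesgue A h + set_lebesgue_integral lebesgue (UNIV - A) h"
        using A by (intro set_integral_Un int) auto
      with compl assms(3) show ?case by simp
    next
      case (union A)
      then have "A i \<in> sets borel" for i
        using borel_G by auto
      then have A: "A i \<in> sets lebesgue" for i
        by auto
      have "set_lebesgue_integral lebesgue (\<Union>i. A i) h = (\<Sum>i. set_lebesgue_integral lebesgue (A i) h)"
        using union(1) A by (intro lebesgue_integral_countable_add int) (auto simp: disjoint_family_on_def)
      with union show ?case by simp
    qed
  qed
  fix A :: "real set" assume A: "A \<in> sets lebesgue"
  then obtain S N N' where S: "A = S \<union> N" "N \<subseteq> N'" "N' \<in> null_sets lborel" "S \<in> sets lborel"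
    by (rule sets_completionE)
  have S_leb: "S \<in> sets lebesgue"
    using S(4) by auto
  have "AE x in lebesgue. x \<notin> N'"
    using S(3) by (intro AE_not_in null_sets_completionI)
  then have "AE x in lebesgue. x \<in> S \<longleftrightarrow> x \<in> A"
    by eventually_elim (use S in auto)
  then have "set_lebesgue_integral lebesgue A h = set_lebesgue_integral lebesgue S h"
    using h A S_leb by (intro set_integral_cong_set) (simp_all add: set_borel_measurable_def)
  then show "set_lebesgue_integral lebesgue A h = 0"
    using borel S(4) by simp
qed

text \<open>The bumps are bounded by 1 and converge to the indicator of an interval, so dominated
  convergence with majorant |h| turns the tested identities into vanishing integrals over
  intervals.\<close>

lemma fundamental_lemma_variations:
  fixes h :: "real \<Rightarrow> real"
  assumes "0 < T" and h: "integrable (time_measure T) h"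
    and zero: "\<And>\<phi>. \<phi> \<in> test_functions T \<Longrightarrow> (LINT t|time_measure T. \<phi> t * h t) = 0"
  shows "AE t in time_measure T. h t = 0"
proof -
  have meas: "h \<in> borel_measurable (time_measure T)"
    using h by auto
  have ind: "(LINT t|time_measure T. indicator {a<..<b} t * h t) = 0" for a b
  proof -
    from bump_tendsto_indicator[OF assms(1)] obtain \<phi> :: "nat \<Rightarrow> real \<Rightarrow> real"
      where \<phi>: "\<And>n. \<phi> n \<in> test_functions T" "\<And>n x. \<bar>\<phi> n x\<bar> \<le> 1"
        "\<And>x. x \<in> {0<..<T} \<Longrightarrow> (\<lambda>n. \<phi> n x) \<longlonglongrightarrow> indicator {a<..<b} x"
      by metis
    have \<phi>_meas: "\<phi> n \<in> borel_measurable (time_measure T)" for n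
    proof -
      have "(deriv ^^ 0) (\<phi> n) differentiable_on UNIV"
        using \<phi>(1)[of n] unfolding test_functions_def by blast
      then have "continuous_on UNIV (\<phi> n)"
        by (simp add: differentiable_imp_continuous_on)
      then have "\<phi> n \<in> borel_measurable lebesgue"
        by (intro measurable_completion) (simp add: borel_measurable_continuous_onI)
      then show ?thesis
        by (rule measurable_restrict_space1)
    qed
    have "(\<lambda>n. LINT t|time_measure T. \<phi> n t * h t) \<longlonglongrightarrow> (LINT t|time_measure T. indicator {a<..<b} t * h t)"
    proof (rule integral_dominated_convergence)
      show "integrable (time_measure T) (\<lambda>t. norm (h t))"
        using h by simp
      show "AE t in time_measure T. (\<lambda>n. \<phi> n t * h t) \<longlonglongrightarrow> indicator {a<..<b} t * h t"
        by (rule AE_I2) (auto intro!: tendsto_mult \<phi>(3))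
      show "AE t in time_measure T. norm (\<phi> n t * h t) \<le> norm (h t)" for n
        using \<phi>(2) by (auto simp: abs_mult intro!: AE_I2 mult_left_le_one_le)
      show "(\<lambda>t. \<phi> n t * h t) \<in> borel_measurable (time_measure T)" for n
        using \<phi>_meas meas by simp
      have "(indicator {a<..<b} :: real \<Rightarrow> real) \<in> borel_measurable (time_measure T)"
        by (intro measurable_restrict_space1 borel_measurable_indicator) simp
      then show "(\<lambda>t. indicator {a<..<b} t * h t) \<in> borel_measurable (time_measure T)"
        using meas by simp
    qed
    then show ?thesis
      using zero[OF \<phi>(1)] by (simp add: LIMSEQ_const_iff)
  qed
  \<comment> \<open>Extension by zero moves the problem to the whole line; its total integral is
    then that over the interval (0,T) and is already covered.\<close>
  define H where "H t = indicator {0<..<T} t * h t" for t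
  have "AE t in lebesgue. H t = 0"
  proof (rule AE_zero_if_interval_integrals_zero)
    show "integrable lebesgue H"
      using h by (simp add: integrable_restrict_space H_def[abs_def])
    have eq: "set_lebesgue_integral lebesgue {a<..<b} H = (LINT t|time_measure T. indicator {a<..<b} t * h t)" for a b
      by (subst integral_restrict_space)
         (auto simp: H_def set_lebesgue_integral_def intro!: Bochner_Integration.integral_cong)
    show *: "set_lebesgue_integral lebesgue {a<..<b} H = 0" for a b
      using eq ind by simp
    have "set_lebesgue_integral lebesgue UNIV H = set_lebesgue_integral lebesgue {0<..<T} H"
      by (auto simp: H_def set_lebesgue_integral_def indicator_def intro!: Bochner_Integration.integral_cong)
    then show "set_lebesgue_integral lebesgue UNIV H = 0"
      using * by simp
  qed
  then show ?thesis
    by (subst AE_restrict_space_iff) (auto simp: H_def elim!: eventually_mono)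
qed

subsection \<open>The Riesz isomorphism and square integrable functions\<close>

text \<open>Stated without a sign condition on C, so that it applies to degenerate forms. It yields
  the Cauchy-Schwarz inequalities for integrals and for the form of \<open>K\<close>, and the
  first-order condition in the Riesz representation.\<close>

lemma quadratic_nonneg_imp_discriminant:
  fixes A B C :: real
  assumes "\<And>s. 0 \<le> A + 2 * s * B + s\<^sup>2 * C"
  shows "B\<^sup>2 \<le> A * C"
proof (cases "C = 0")
  case True
  have "B = 0"
  proof (rule ccontr)
    assume "B \<noteq> 0"
    \<comment> \<open>The polynomial is affine here, and this s gives it the value -1.\<close>
    then have "2 * (- (A + 1) / (2 * B)) * B = - (A + 1)"
      by simp
    then show False
      using assms[of "- (A + 1) / (2 * B)"] unfolding True by simp
  qed
  then show ?thesis
    using True by simp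
next
  case False
  have "0 \<le> C"
  proof (rule ccontr)
    assume C: "\<not> 0 \<le> C"
    \<comment> \<open>Large enough that \<open>2 * B + s * C\<close> is at most -|A| - 1 when C < 0;
      the summand 1 makes s \<ge> 1, so the polynomial falls to -1 or below.\<close>
    define s where "s = (\<bar>A\<bar> + 2 * \<bar>B\<bar> + 1) / \<bar>C\<bar> + 1"
    have s: "1 \<le> s" "s * C = - (\<bar>A\<bar> + 2 * \<bar>B\<bar> + 1) + C"
      using C by (auto simp: s_def field_simps)
    have "A + 2 * s * B + s\<^sup>2 * C = A + s * (2 * B + s * C)"
      by (simp add: algebra_simps power2_eq_square)
    also have "2 * B + s * C \<le> - \<bar>A\<bar> - 1"
      using C s(2) by linarith
    then have "A + s * (2 * B + s * C) \<le> A + s * (- \<bar>A\<bar> - 1)"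
      using s(1) by (simp add: mult_left_mono)
    also have "s * (- \<bar>A\<bar> - 1) \<le> 1 * (- \<bar>A\<bar> - 1)"
      using s(1) by (intro mult_right_mono_neg) auto
    finally show False
      using assms[of s] by simp
  qed
  with False have "0 < C" by simp
  \<comment> \<open>s = -B/C is the minimiser of the polynomial.\<close>
  have "A + 2 * (- B / C) * B + (- B / C)\<^sup>2 * C = A - B\<^sup>2 / C"
    using False by (simp add: power2_eq_square)
  then have "B\<^sup>2 / C \<le> A"
    using assms[of "- B / C"] by simp
  then show ?thesis
    using \<open>0 < C\<close> by (simp add: field_simps)
qed

text \<open>A maximising sequence of F on the unit ball is Cauchy by the parallelogram law, and
  completeness gives a unit vector y at which F attains its norm. Stationarity at y then determines
  F in every direction h.\<close>

lemma blinfun_Riesz: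
  fixes F :: "'v::{real_inner, banach} \<Rightarrow>\<^sub>L real"
  shows "\<exists>v. \<forall>x. blinfun_apply F x = v \<bullet> x"
proof (cases "F = 0")
  case True
  then show ?thesis
    by (intro exI[of _ 0]) simp
next
  case False
  define N where "N = norm F"
  have N: "0 < N"
    using False by (simp add: N_def)
  have bound: "\<bar>blinfun_apply F x\<bar> \<le> N * norm x" for x
    using norm_blinfun[of F x] by (simp add: N_def)
  define e where "e n = 1 / real (Suc n)" for n
  have e: "0 < e n" "e n \<le> 1" for n
    by (auto simp: e_def)
  have e_lim: "e \<longlonglongrightarrow> 0"
    using LIMSEQ_inverse_real_of_nat unfolding e_def[abs_def] by (simp add: inverse_eq_divide)
  have "\<exists>x. norm x \<le> 1 \<and> N * (1 - e n) < blinfun_apply F x" for n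
  proof (rule ccontr)
    assume "\<not> ?thesis"
    then have *: "blinfun_apply F x \<le> N * (1 - e n)" if "norm x \<le> 1" for x
      using that by force
    have "N \<le> N * (1 - e n)"
      unfolding N_def
    proof (rule norm_blinfun_bound)
      show "0 \<le> norm F * (1 - e n)"
        using e by simp
      fix x :: 'v
      show "norm (blinfun_apply F x) \<le> norm F * (1 - e n) * norm x"
      proof (cases "x = 0")
        case nz: False
        have "blinfun_apply F (x /\<^sub>R norm x) \<le> N * (1 - e n)"
          "blinfun_apply F (- x /\<^sub>R norm x) \<le> N * (1 - e n)"
          using nz by (auto intro!: *)
        then have "\<bar>blinfun_apply F x / norm x\<bar> \<le> N * (1 - e n)"
          by (simp add: blinfun.scaleR_right blinfun.minus_right divide_inverse mult.commute)
        then show ?thesis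
          using nz by (simp add: N_def field_simps)
      qed simp
    qed
    then show False
      using mult_pos_pos[OF N e(1)[of n]] by (simp add: algebra_simps)
  qed
  then obtain x where x: "\<And>n. norm (x n) \<le> 1" "\<And>n. N * (1 - e n) < blinfun_apply F (x n)"
    by metis
  have dist: "(norm (x n - x m))\<^sup>2 \<le> 4 * (e n + e m)" for n m
  proof -
    have "N * ((1 - e n) + (1 - e m)) \<le> blinfun_apply F (x n + x m)"
      using x(2)[of n] x(2)[of m] by (simp add: blinfun.add_right algebra_simps)
    also have "\<dots> \<le> N * norm (x n + x m)"
      using bound[of "x n + x m"] by simp
    finally have "(1 - e n) + (1 - e m) \<le> norm (x n + x m)"
      using N by (simp only: mult_le_cancel_left_pos)
    then have le: "2 - (e n + e m) \<le> norm (x n + x m)"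
      by simp
    \<comment> \<open>Expanding (2 - d)^2 and dropping d^2, with d = e n + e m. In the next step e n
      \<le> 1 keeps 2 - d nonnegative, so that squaring is monotone.\<close>
    have "4 - 4 * (e n + e m) \<le> (2 - (e n + e m))\<^sup>2"
      using zero_le_power2[of "e n + e m"] by (simp add: power2_eq_square algebra_simps)
    also have "\<dots> \<le> (norm (x n + x m))\<^sup>2"
      using le e[of n] e[of m] by (intro power_mono) auto
    finally have "4 - 4 * (e n + e m) \<le> (norm (x n + x m))\<^sup>2" .
    moreover have "(norm (x n - x m))\<^sup>2 + (norm (x n + x m))\<^sup>2 = 2 * (norm (x n))\<^sup>2 + 2 * (norm (x m))\<^sup>2"
      by (simp add: power2_norm_eq_inner inner_simps inner_commute)
    moreover have "(norm (x n))\<^sup>2 \<le> 1" "(norm (x m))\<^sup>2 \<le> 1"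
      using x(1) by (auto simp: power_le_one)
    ultimately show ?thesis by simp
  qed
  have "Cauchy x"
  proof (rule CauchyI)
    fix r :: real assume "0 < r"
    then have "0 < r\<^sup>2 / 8" by simp
    from order_tendstoD(2)[OF e_lim this] obtain M where M: "\<And>n. n \<ge> M \<Longrightarrow> e n < r\<^sup>2 / 8"
      by (auto simp: eventually_sequentially)
    have "norm (x m - x n) < r" if "m \<ge> M" "n \<ge> M" for m n
    proof -
      have "(norm (x m - x n))\<^sup>2 < r\<^sup>2"
        using dist[of m n] M[OF that(1)] M[OF that(2)] by simp
      then show ?thesis
        using \<open>0 < r\<close> by (simp add: power2_less_imp_less)
    qed
    then show "\<exists>M. \<forall>m\<ge>M. \<forall>n\<ge>M. norm (x m - x n) < r"
      by blast
  qed
  then obtain y where y: "x \<longlonglongrightarrow> y"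
    using Cauchy_convergent_iff convergent_def by blast
  have "norm y \<le> 1"
    using y x(1) by (intro Lim_bounded[OF tendsto_norm[OF y]]) auto
  have "(\<lambda>n. N * (1 - e n)) \<longlonglongrightarrow> N * (1 - 0)"
    by (intro tendsto_intros e_lim)
  then have "N * (1 - 0) \<le> blinfun_apply F y"
    by (rule LIMSEQ_le[OF _ blinfun.tendsto[OF tendsto_const y]]) (use x(2) in \<open>auto intro: less_imp_le\<close>)
  then have "N \<le> blinfun_apply F y"
    by simp
  moreover have "blinfun_apply F y \<le> N * norm y" "N * norm y \<le> N"
    using bound[of y] N \<open>norm y \<le> 1\<close> by auto
  ultimately have Fy: "blinfun_apply F y = N" and "N * norm y = N * 1"
    by linarith+
  then have "norm y = 1"
    using N by simp
  then have yy: "y \<bullet> y = 1"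
    by (simp add: dot_square_norm)
  have "blinfun_apply F h = (N *\<^sub>R y) \<bullet> h" for h
  proof -
    \<comment> \<open>The gap N^2 |y + s h|^2 - F(y + s h)^2 is nonnegative and vanishes at s = 0.
      With constant term 0 the discriminant bound forces the linear coefficient to be 0, which is
      the claim for h.\<close>
    have "0 \<le> 0 + 2 * s * (N * (N * (y \<bullet> h) - blinfun_apply F h)) + s\<^sup>2 * (N\<^sup>2 * (h \<bullet> h) - (blinfun_apply F h)\<^sup>2)" for s
    proof -
      have "\<bar>blinfun_apply F (y + s *\<^sub>R h)\<bar>\<^sup>2 \<le> (N * norm (y + s *\<^sub>R h))\<^sup>2"
        by (intro power_mono bound) auto
      then have "(N + s * blinfun_apply F h)\<^sup>2 \<le> N\<^sup>2 * ((y + s *\<^sub>R h) \<bullet> (y + s *\<^sub>R h))"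
        by (simp add: power_mult_distrib power2_norm_eq_inner blinfun.add_right blinfun.scaleR_right Fy)
      then show ?thesis
        by (simp add: inner_simps yy power2_norm_eq_inner inner_commute power2_eq_square algebra_simps)
    qed
    from quadratic_nonneg_imp_discriminant[OF this] show ?thesis
      using N by simp
  qed
  then show ?thesis
    by blast
qed

definition riesz :: "('v::{real_inner, banach} \<Rightarrow>\<^sub>L real) \<Rightarrow> 'v" where
  "riesz F = (SOME v. \<forall>x. blinfun_apply F x = v \<bullet> x)"

lemma riesz: "blinfun_apply F x = riesz F \<bullet> x"
  unfolding riesz_def using someI_ex[OF blinfun_Riesz[of F]] by blast

lemma riesz_diff: "riesz (F - G) = riesz F - riesz G"
proof -
  have "(riesz (F - G) - (riesz F - riesz G)) \<bullet> x = 0" for x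
    by (simp add: inner_diff_left riesz[symmetric] blinfun.diff_left)
  from this[of "riesz (F - G) - (riesz F - riesz G)"] show ?thesis
    by simp
qed

lemma norm_riesz_le: "norm (riesz F) \<le> norm F"
proof -
  have "(norm (riesz F))\<^sup>2 \<le> norm F * norm (riesz F)"
    using norm_blinfun[of F "riesz F"] by (simp add: riesz dot_square_norm)
  then show ?thesis
    by (cases "riesz F = 0") (auto simp: power2_eq_square)
qed

text \<open>Linearity and \<open>norm_riesz_le\<close> make the Riesz map nonexpansive, hence Borel.
  Thus measurability of V'-valued functions is transported to V, where the inner product of
  measurable functions is measurable.\<close>

lemma continuous_on_riesz: "continuous_on UNIV riesz"
  using norm_riesz_le
  by (intro lipschitz_on_continuous_on[of 1] lipschitz_onI) (auto simp: dist_norm riesz_diff[symmetric])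

lemma borel_measurable_riesz:
  "F \<in> borel_measurable M \<Longrightarrow> (\<lambda>t. riesz (F t)) \<in> borel_measurable M"
  using borel_measurable_continuous_onI[OF continuous_on_riesz] by (rule measurable_compose[rotated])

lemma borel_measurable_dual_pairing:
  fixes F :: "'a \<Rightarrow> ('v::{real_inner, banach, second_countable_topology} \<Rightarrow>\<^sub>L real)"
  assumes "F \<in> borel_measurable M" "v \<in> borel_measurable M"
  shows "(\<lambda>t. blinfun_apply (F t) (v t)) \<in> borel_measurable M"
  unfolding riesz using assms by (intro borel_measurable_inner borel_measurable_riesz)

text \<open>The sum rule for Borel functions is stated in the library for a second countable codomain;
  through the Riesz isomorphism it is inherited by the dual.\<close>

lemma borel_measurable_dual_diff:
  fixes F G :: "'a \<Rightarrow> ('v::{real_inner, banach, second_countable_topology} \<Rightarrow>\<^sub>L real)"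
  assumes "F \<in> borel_measurable M" "G \<in> borel_measurable M"
  shows "(\<lambda>t. F t - G t) \<in> borel_measurable M"
proof -
  have "F t - G t = blinfun_inner_right (riesz (F t) - riesz (G t))" for t
    by (rule blinfun_eqI) (simp add: riesz[symmetric] blinfun.diff_left inner_diff_left)
  moreover have "continuous_on UNIV (blinfun_inner_right :: 'v \<Rightarrow> 'v \<Rightarrow>\<^sub>L real)"
    by (simp add: linear_continuous_on bounded_linear_blinfun_inner_right)
  then have "blinfun_inner_right \<in> borel_measurable (borel :: 'v measure)"
    by (rule borel_measurable_continuous_onI)
  ultimately show ?thesis
    using borel_measurable_diff[OF assms[THEN borel_measurable_riesz]]
    by (auto intro: measurable_compose[rotated])
qed

text \<open>The integral of (f + s g)^2 is a nonnegative polynomial in s; its cross term exists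
  because |f g| is dominated by f^2 + g^2.\<close>

lemma
  fixes f g :: "'a \<Rightarrow> real"
  assumes [measurable]: "f \<in> borel_measurable M" "g \<in> borel_measurable M"
    and sq: "integrable M (\<lambda>t. (f t)\<^sup>2)" "integrable M (\<lambda>t. (g t)\<^sup>2)"
  shows integrable_mult_square_integrable: "integrable M (\<lambda>t. f t * g t)"
    and Cauchy_Schwarz_integral:
      "\<bar>LINT t|M. f t * g t\<bar> \<le> sqrt (LINT t|M. (f t)\<^sup>2) * sqrt (LINT t|M. (g t)\<^sup>2)"
proof -
  show int: "integrable M (\<lambda>t. f t * g t)"
  proof (rule Bochner_Integration.integrable_bound)
    show "integrable M (\<lambda>t. (f t)\<^sup>2 + (g t)\<^sup>2)"
      using sq by simp
    have "\<bar>f t * g t\<bar> \<le> (f t)\<^sup>2 + (g t)\<^sup>2" for t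
    proof -
      have "2 * (\<bar>f t\<bar> * \<bar>g t\<bar>) \<le> (f t)\<^sup>2 + (g t)\<^sup>2" "0 \<le> \<bar>f t\<bar> * \<bar>g t\<bar>"
        using sum_squares_bound[of "\<bar>f t\<bar>" "\<bar>g t\<bar>"] by (simp_all add: mult.assoc)
      then show ?thesis
        unfolding abs_mult by linarith
    qed
    then show "AE t in M. norm (f t * g t) \<le> norm ((f t)\<^sup>2 + (g t)\<^sup>2)"
      by simp
  qed simp
  have "(LINT t|M. f t * g t)\<^sup>2 \<le> (LINT t|M. (f t)\<^sup>2) * (LINT t|M. (g t)\<^sup>2)"
  proof (rule quadratic_nonneg_imp_discriminant)
    fix s :: real
    have "0 \<le> (LINT t|M. (f t + s * g t)\<^sup>2)"
      by (simp add: integral_nonneg_AE)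
    also have "\<dots> = (LINT t|M. (f t)\<^sup>2 + 2 * s * (f t * g t) + s\<^sup>2 * (g t)\<^sup>2)"
      by (simp add: power2_eq_square algebra_simps)
    also have "\<dots> = (LINT t|M. (f t)\<^sup>2) + 2 * s * (LINT t|M. f t * g t) + s\<^sup>2 * (LINT t|M. (g t)\<^sup>2)"
      using int sq by simp
    finally show "0 \<le> (LINT t|M. (f t)\<^sup>2) + 2 * s * (LINT t|M. f t * g t) + s\<^sup>2 * (LINT t|M. (g t)\<^sup>2)" .
  qed
  from real_sqrt_le_mono[OF this]
  show "\<bar>LINT t|M. f t * g t\<bar> \<le> sqrt (LINT t|M. (f t)\<^sup>2) * sqrt (LINT t|M. (g t)\<^sup>2)"
    by (simp add: real_sqrt_mult)
qed

subsection \<open>Weak derivatives\<close>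

lemma finite_measure_time_measure: "finite_measure (time_measure T)"
  by (rule finite_measureI)
     (use emeasure_bounded_finite[of "{0<..<T}"] in \<open>simp add: emeasure_restrict_space\<close>)

section \<open>Estimates in L2 and the dual pairing\<close>

lemma L2_D:
  assumes "f \<in> L2 T"
  shows "f \<in> borel_measurable (time_measure T)" "integrable (time_measure T) (\<lambda>t. (norm (f t))\<^sup>2)"
    "(\<lambda>t. norm (f t)) \<in> borel_measurable (time_measure T)"
  using assms by (auto simp: L2_def)

lemma L2_norm_nonneg [simp]: "0 \<le> L2_norm T f"
  by (simp add: L2_norm_def integral_nonneg_AE)

lemma L2_zero: "(\<lambda>t. 0) \<in> L2 T"
  by (simp add: L2_def)

lemma L2_scaleR:
  fixes f :: "real \<Rightarrow> 'b::real_normed_vector"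
  assumes "f \<in> L2 T"
  shows "(\<lambda>t. s *\<^sub>R f t) \<in> L2 T"
proof -
  have "(\<lambda>x::'b. s *\<^sub>R x) \<in> borel_measurable borel"
    by (intro borel_measurable_continuous_onI continuous_intros)
  from measurable_compose[OF L2_D(1)[OF assms] this] show ?thesis
    using L2_D(2)[OF assms] by (simp add: L2_def power_mult_distrib)
qed

text \<open>Measurability stays a hypothesis because it has different proofs for V-valued and
  V'-valued sums, whereas the norm estimate is common to both.\<close>

lemma L2_if_norm_le_sum:
  assumes "f \<in> L2 T" "g \<in> L2 T" and meas: "h \<in> borel_measurable (time_measure T)"
    and le: "\<And>t. norm (h t) \<le> norm (f t) + norm (g t)"
  shows "h \<in> L2 T"
proof -
  have "integrable (time_measure T) (\<lambda>t. (norm (h t))\<^sup>2)"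
  proof (rule Bochner_Integration.integrable_bound)
    show "integrable (time_measure T) (\<lambda>t. 2 * (norm (f t))\<^sup>2 + 2 * (norm (g t))\<^sup>2)"
      using L2_D[OF assms(1)] L2_D[OF assms(2)] by simp
    have "(norm (h t))\<^sup>2 \<le> 2 * (norm (f t))\<^sup>2 + 2 * (norm (g t))\<^sup>2" for t
    proof -
      have "(norm (h t))\<^sup>2 \<le> (norm (f t) + norm (g t))\<^sup>2"
        using le by (intro power_mono) auto
      also have "\<dots> \<le> 2 * (norm (f t))\<^sup>2 + 2 * (norm (g t))\<^sup>2"
        using sum_squares_bound[of "norm (f t)" "norm (g t)"] by (simp add: power2_sum)
      finally show ?thesis .
    qed
    then show "AE t in time_measure T. norm ((norm (h t))\<^sup>2) \<le> norm (2 * (norm (f t))\<^sup>2 + 2 * (norm (g t))\<^sup>2)"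
      by simp
    show "(\<lambda>t. (norm (h t))\<^sup>2) \<in> borel_measurable (time_measure T)"
      using meas by simp
  qed
  with meas show ?thesis
    by (simp add: L2_def)
qed

lemma L2_add:
  fixes f g :: "real \<Rightarrow> 'b::{real_normed_vector, second_countable_topology}"
  assumes "f \<in> L2 T" "g \<in> L2 T"
  shows "(\<lambda>t. f t + g t) \<in> L2 T"
  by (rule L2_if_norm_le_sum[OF assms]) (auto intro: borel_measurable_add L2_D assms norm_triangle_ineq)

lemma L2_diff:
  fixes f g :: "real \<Rightarrow> 'b::{real_normed_vector, second_countable_topology}"
  assumes "f \<in> L2 T" "g \<in> L2 T"
  shows "(\<lambda>t. f t - g t) \<in> L2 T"
  by (rule L2_if_norm_le_sum[OF assms]) (auto intro: borel_measurable_diff L2_D assms norm_triangle_ineq4)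

lemma L2_dual_diff:
  fixes F G :: "real \<Rightarrow> ('v::{real_inner, banach, second_countable_topology} \<Rightarrow>\<^sub>L real)"
  assumes "F \<in> L2 T" "G \<in> L2 T"
  shows "(\<lambda>t. F t - G t) \<in> L2 T"
  by (rule L2_if_norm_le_sum[OF assms]) (auto intro: borel_measurable_dual_diff L2_D assms norm_triangle_ineq4)

lemma L2_const: "(\<lambda>t. v) \<in> L2 T"
  using finite_measure.integrable_const[OF finite_measure_time_measure] by (simp add: L2_def)

text \<open>Common source of two bounds: the pairing of V' and V, with C = 1, and the form
  \<open>a\<close>, with its boundedness constant.\<close>

lemma L2_bilinear_bound:
  assumes "f \<in> L2 T" "g \<in> L2 T" and meas: "h \<in> borel_measurable (time_measure T)"
    and "0 \<le> C" and le: "AE t in time_measure T. \<bar>h t\<bar> \<le> C * (norm (f t) * norm (g t))"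
  shows "integrable (time_measure T) h \<and> \<bar>LINT t|time_measure T. h t\<bar> \<le> C * (L2_norm T f * L2_norm T g)"
proof -
  note int = integrable_mult_square_integrable[OF L2_D(3)[OF assms(1)] L2_D(3)[OF assms(2)] L2_D(2)[OF assms(1)] L2_D(2)[OF assms(2)]]
  note CS = Cauchy_Schwarz_integral[OF L2_D(3)[OF assms(1)] L2_D(3)[OF assms(2)] L2_D(2)[OF assms(1)] L2_D(2)[OF assms(2)]]
  have Cint: "integrable (time_measure T) (\<lambda>t. C * (norm (f t) * norm (g t)))"
    using int by simp
  have h: "integrable (time_measure T) h"
    by (rule Bochner_Integration.integrable_bound[OF Cint meas]) (use le assms(4) in \<open>auto simp: abs_mult\<close>)
  have "\<bar>LINT t|time_measure T. h t\<bar> \<le> (LINT t|time_measure T. \<bar>h t\<bar>)"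
    by (rule integral_abs_bound)
  also have "\<dots> \<le> (LINT t|time_measure T. C * (norm (f t) * norm (g t)))"
    using h Cint le by (intro integral_mono_AE) auto
  also have "\<dots> = C * (LINT t|time_measure T. norm (f t) * norm (g t))"
    by simp
  also have "\<dots> \<le> C * (L2_norm T f * L2_norm T g)"
    using CS assms(4) unfolding L2_norm_def by (intro mult_left_mono) auto
  finally show ?thesis
    using h by blast
qed

lemma
  fixes F :: "real \<Rightarrow> ('v::{real_inner, banach, second_countable_topology} \<Rightarrow>\<^sub>L real)"
  assumes "F \<in> L2 T" "v \<in> L2 T"
  shows integrable_dual_pairing: "integrable (time_measure T) (\<lambda>t. blinfun_apply (F t) (v t))"
    and dual_pairing_bound: "\<bar>LINT t|time_measure T. blinfun_apply (F t) (v t)\<bar> \<le> L2_norm T F * L2_norm T v"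
proof -
  have "integrable (time_measure T) (\<lambda>t. blinfun_apply (F t) (v t)) \<and>
    \<bar>LINT t|time_measure T. blinfun_apply (F t) (v t)\<bar> \<le> 1 * (L2_norm T F * L2_norm T v)"
  proof (rule L2_bilinear_bound[OF assms borel_measurable_dual_pairing])
    show "AE t in time_measure T. \<bar>blinfun_apply (F t) (v t)\<bar> \<le> 1 * (norm (F t) * norm (v t))"
      using norm_blinfun[of "F t" "v t" for t] by simp
  qed (simp_all add: L2_D assms)
  then show "integrable (time_measure T) (\<lambda>t. blinfun_apply (F t) (v t))"
    "\<bar>LINT t|time_measure T. blinfun_apply (F t) (v t)\<bar> \<le> L2_norm T F * L2_norm T v"
    unfolding mult_1 by blast+
qed

text \<open>Continuity on the whole line bounds the factor on the compact [0,T]. It is applied both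
  to a test function and to its derivative.\<close>

lemma integrable_continuous_mult:
  fixes \<phi> h :: "real \<Rightarrow> real"
  assumes "continuous_on UNIV \<phi>" and h: "integrable (time_measure T) h"
  shows "integrable (time_measure T) (\<lambda>t. \<phi> t * h t)"
proof -
  have "compact (\<phi> ` {0..T})"
    by (intro compact_continuous_image continuous_on_subset[OF assms(1)]) auto
  then have "bounded (\<phi> ` {0..T})"
    by (rule compact_imp_bounded)
  then obtain C where "\<forall>y\<in>\<phi> ` {0..T}. norm y \<le> C"
    by (meson bounded_iff)
  then have C: "\<bar>\<phi> t\<bar> \<le> C" if "t \<in> {0..T}" for t
    using that by simp
  have \<phi>: "\<phi> \<in> borel_measurable (time_measure T)"
    using assms(1) by (intro measurable_restrict_space1 measurable_completion) (simp add: borel_measurable_continuous_onI)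
  show ?thesis
  proof (rule Bochner_Integration.integrable_bound)
    show "integrable (time_measure T) (\<lambda>t. C * h t)"
      using h by simp
    show "(\<lambda>t. \<phi> t * h t) \<in> borel_measurable (time_measure T)"
      using \<phi> h by simp
    show "AE t in time_measure T. norm (\<phi> t * h t) \<le> norm (C * h t)"
      using C by (intro AE_I2) (auto simp: abs_mult intro!: mult_right_mono order_trans[OF C abs_ge_self])
  qed
qed

lemma test_function_continuous:
  assumes "\<phi> \<in> test_functions T"
  shows "continuous_on UNIV \<phi>" "continuous_on UNIV (deriv \<phi>)"
proof -
  have *: "(deriv ^^ k) \<phi> differentiable_on UNIV" for k
    using assms unfolding test_functions_def by blast
  show "continuous_on UNIV \<phi>" "continuous_on UNIV (deriv \<phi>)"
    using *[of 0] *[of 1] by (auto intro: differentiable_imp_continuous_on)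
qed

section \<open>Uniqueness and differences of weak derivatives\<close>

lemma has_weak_derivativeD:
  assumes "has_weak_derivative T f g" "\<phi> \<in> test_functions T"
  shows "(LINT t|time_measure T. deriv \<phi> t * blinfun_apply (f t) v) =
    - (LINT t|time_measure T. \<phi> t * blinfun_apply (g t) v)"
  using assms unfolding has_weak_derivative_def by blast

lemma has_weak_derivative_diff:
  fixes f g :: "real \<Rightarrow> ('v::{real_inner, banach, second_countable_topology} \<Rightarrow>\<^sub>L real)"
  assumes L2: "f \<in> L2 T" "f' \<in> L2 T" "g \<in> L2 T" "g' \<in> L2 T"
    and "has_weak_derivative T f f'" "has_weak_derivative T g g'"
  shows "has_weak_derivative T (\<lambda>t. f t - g t) (\<lambda>t. f' t - g' t)"
  unfolding has_weak_derivative_def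
proof (intro ballI allI)
  fix \<phi> v assume \<phi>: "\<phi> \<in> test_functions T"
  have int: "integrable (time_measure T) (\<lambda>t. \<phi> t * blinfun_apply (F t) v)"
    "integrable (time_measure T) (\<lambda>t. deriv \<phi> t * blinfun_apply (F t) v)" if "F \<in> L2 T" for F :: "real \<Rightarrow> 'v \<Rightarrow>\<^sub>L real"
    by (intro integrable_continuous_mult test_function_continuous[OF \<phi>]
        integrable_dual_pairing[where v = "\<lambda>t. v", OF that L2_const])+
  show "(LINT t|time_measure T. deriv \<phi> t * blinfun_apply (f t - g t) v) =
        - (LINT t|time_measure T. \<phi> t * blinfun_apply (f' t - g' t) v)"
    using int L2 by (simp add: blinfun.diff_left right_diff_distrib
        has_weak_derivativeD[OF assms(5) \<phi>] has_weak_derivativeD[OF assms(6) \<phi>])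
qed

text \<open>For each fixed d in V the fundamental lemma gives equality off a null set depending on
  d. A countable dense set of d leaves a single null set, and off it two continuous functionals that
  agree on a dense set coincide.\<close>

lemma weak_derivative_unique:
  fixes f g g' :: "real \<Rightarrow> ('v::{real_inner, banach, second_countable_topology} \<Rightarrow>\<^sub>L real)"
  assumes "0 < T" and L2: "g \<in> L2 T" "g' \<in> L2 T"
    and "has_weak_derivative T f g" "has_weak_derivative T f g'"
  shows "AE t in time_measure T. g t = g' t"
proof -
  obtain D :: "'v set" where D: "countable D" "\<And>U. open U \<Longrightarrow> U \<noteq> {} \<Longrightarrow> \<exists>d\<in>D. d \<in> U"
    using countable_dense_setE by blast
  have "AE t in time_measure T. blinfun_apply (g t) d - blinfun_apply (g' t) d = 0" for d
  proof (rule fundamental_lemma_variations[OF assms(1)])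
    show "integrable (time_measure T) (\<lambda>t. blinfun_apply (g t) d - blinfun_apply (g' t) d)"
      by (intro Bochner_Integration.integrable_diff integrable_dual_pairing[where v = "\<lambda>t. d", OF _ L2_const] L2)
    fix \<phi> assume \<phi>: "\<phi> \<in> test_functions T"
    have int: "integrable (time_measure T) (\<lambda>t. \<phi> t * blinfun_apply (F t) d)" if "F \<in> L2 T" for F :: "real \<Rightarrow> 'v \<Rightarrow>\<^sub>L real"
      by (intro integrable_continuous_mult test_function_continuous[OF \<phi>]
          integrable_dual_pairing[where v = "\<lambda>t. d", OF that L2_const])
    have "(LINT t|time_measure T. \<phi> t * blinfun_apply (g t) d) = (LINT t|time_measure T. \<phi> t * blinfun_apply (g' t) d)"
      using has_weak_derivativeD[OF assms(4) \<phi>, of d] has_weak_derivativeD[OF assms(5) \<phi>, of d] by linarith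
    then show "(LINT t|time_measure T. \<phi> t * (blinfun_apply (g t) d - blinfun_apply (g' t) d)) = 0"
      using int L2 by (simp add: right_diff_distrib)
  qed
  then have "AE t in time_measure T. \<forall>d\<in>D. blinfun_apply (g t) d = blinfun_apply (g' t) d"
    using D(1) by (simp add: AE_ball_countable)
  then show ?thesis
  proof eventually_elim
    case (elim t)
    have "closed {x. blinfun_apply (g t) x = blinfun_apply (g' t) x}"
      by (intro closed_Collect_eq continuous_intros)
    then have "\<not> (\<exists>x. blinfun_apply (g t) x \<noteq> blinfun_apply (g' t) x)"
      using D(2)[of "- {x. blinfun_apply (g t) x = blinfun_apply (g' t) x}"] elim by auto
    then show ?case
      by (auto intro: blinfun_eqI)
  qed
qed

lemma weak_deriv_if_H1:
  assumes "f \<in> H1 T"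
  shows "weak_deriv T f \<in> L2 T" "has_weak_derivative T f (weak_deriv T f)"
proof -
  have "\<exists>g. g \<in> L2 T \<and> has_weak_derivative T f g"
    using assms by (auto simp: H1_def)
  from someI_ex[OF this] show "weak_deriv T f \<in> L2 T" "has_weak_derivative T f (weak_deriv T f)"
    by (simp_all add: weak_deriv_def)
qed

text \<open>The difference of the chosen derivatives is one weak derivative of f - g, and
  \<open>weak_deriv\<close> may choose another; uniqueness identifies them almost
  everywhere.\<close>

lemma
  fixes f g :: "real \<Rightarrow> ('v::{real_inner, banach, second_countable_topology} \<Rightarrow>\<^sub>L real)"
  assumes "0 < T" "f \<in> H1 T" "g \<in> H1 T"
  shows H1_diff: "(\<lambda>t. f t - g t) \<in> H1 T"
    and weak_deriv_diff:
      "AE t in time_measure T. weak_deriv T (\<lambda>s. f s - g s) t = weak_deriv T f t - weak_deriv T g t"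
proof -
  note wf = weak_deriv_if_H1[OF assms(2)] and wg = weak_deriv_if_H1[OF assms(3)]
  have "f \<in> L2 T" "g \<in> L2 T"
    using assms by (auto simp: H1_def)
  then have d: "has_weak_derivative T (\<lambda>t. f t - g t) (\<lambda>t. weak_deriv T f t - weak_deriv T g t)"
    using wf wg by (intro has_weak_derivative_diff)
  with \<open>f \<in> L2 T\<close> \<open>g \<in> L2 T\<close> show H1: "(\<lambda>t. f t - g t) \<in> H1 T"
    using wf wg by (auto simp: H1_def intro!: L2_dual_diff)
  show "AE t in time_measure T. weak_deriv T (\<lambda>s. f s - g s) t = weak_deriv T f t - weak_deriv T g t"
    by (rule weak_derivative_unique[OF assms(1) _ _ weak_deriv_if_H1(2)[OF H1] d])
       (use wf wg weak_deriv_if_H1[OF H1] in \<open>auto intro: L2_dual_diff\<close>)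
qed

section \<open>Differences in X and the time derivative operator\<close>

lemma blinfun_apply_H_to_dual:
  "bounded_linear j \<Longrightarrow> blinfun_apply (H_to_dual j h) v = h \<bullet> j v"
  unfolding H_to_dual_def
  by (subst bounded_linear_Blinfun_apply) (auto intro: bounded_linear_compose[OF bounded_linear_inner_right])

lemma H_to_dual_diff:
  assumes "bounded_linear j"
  shows "H_to_dual j (j (x - y)) = H_to_dual j (j x) - H_to_dual j (j y)"
  by (rule blinfun_eqI)
     (simp add: blinfun_apply_H_to_dual[OF assms] blinfun.diff_left inner_diff_left
       linear_diff[OF bounded_linear.linear[OF assms]])

lemma
  fixes j :: "'v::{real_inner, banach, second_countable_topology} \<Rightarrow> 'h::real_inner"
  assumes "0 < T" "bounded_linear j" "u \<in> Xspace T j" "w \<in> Xspace T j"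
  shows Xspace_diff: "(\<lambda>t. u t - w t) \<in> Xspace T j"
    and dt_op_diff: "v \<in> Yspace T \<Longrightarrow> dt_op T j (\<lambda>t. u t - w t) v = dt_op T j u v - dt_op T j w v"
proof -
  have H1: "(\<lambda>t. H_to_dual j (j (u t))) \<in> H1 T" "(\<lambda>t. H_to_dual j (j (w t))) \<in> H1 T"
    and L2: "u \<in> L2 T" "w \<in> L2 T"
    using assms by (auto simp: Xspace_def)
  note d = H1_diff[OF assms(1) H1] weak_deriv_diff[OF assms(1) H1]
  show *: "(\<lambda>t. u t - w t) \<in> Xspace T j"
    using d(1) L2 by (simp add: Xspace_def L2_diff H_to_dual_diff[OF assms(2)])
  assume v: "v \<in> Yspace T"
  then have vL2: "v \<in> L2 T"
    by (simp add: Yspace_def)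
  note int = integrable_dual_pairing[OF weak_deriv_if_H1(1) vL2]
  have "(LINT t|time_measure T. blinfun_apply (weak_deriv T (\<lambda>s. H_to_dual j (j (u s)) - H_to_dual j (j (w s))) t) (v t))
    = (LINT t|time_measure T. blinfun_apply (weak_deriv T (\<lambda>s. H_to_dual j (j (u s))) t) (v t)
        - blinfun_apply (weak_deriv T (\<lambda>s. H_to_dual j (j (w s))) t) (v t))"
  proof (rule integral_cong_AE)
    show "AE t in time_measure T. blinfun_apply (weak_deriv T (\<lambda>s. H_to_dual j (j (u s)) - H_to_dual j (j (w s))) t) (v t)
      = blinfun_apply (weak_deriv T (\<lambda>s. H_to_dual j (j (u s))) t) (v t)
        - blinfun_apply (weak_deriv T (\<lambda>s. H_to_dual j (j (w s))) t) (v t)"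
      using d(2) by eventually_elim (simp add: blinfun.diff_left)
  qed (use int[OF d(1)] int[OF H1(1)] int[OF H1(2)] in auto)
  then show "dt_op T j (\<lambda>t. u t - w t) v = dt_op T j u v - dt_op T j w v"
    using v int[OF H1(1)] int[OF H1(2)] by (simp add: dt_op_def H_to_dual_diff[OF assms(2)])
qed

subsection \<open>The parabolic operator\<close>

lemma bounded_bilinear_if_bilinear:
  assumes "bilinear f" "\<And>x y. \<bar>f x y\<bar> \<le> C * norm x * norm y"
  shows "bounded_bilinear (f :: 'v::real_normed_vector \<Rightarrow> 'v \<Rightarrow> real)"
proof
  show "\<exists>K. \<forall>a b. norm (f a b) \<le> norm a * norm b * K"
    using assms(2) by (intro exI[of _ C]) (simp add: mult.assoc mult.commute mult.left_commute)
qed (use assms(1) in \<open>simp_all add: bilinear_ladd bilinear_radd bilinear_lmul bilinear_rmul\<close>)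

text \<open>Completeness of Lebesgue measure: whatever g does on N, the part of a preimage inside N
  is a subset of a null set and so measurable.\<close>

lemma borel_measurable_time_measure_cong_AE:
  fixes f g :: "real \<Rightarrow> real"
  assumes f: "f \<in> borel_measurable (time_measure T)" and N: "N \<in> null_sets (time_measure T)"
    and eq: "\<And>t. t \<in> {0<..<T} - N \<Longrightarrow> f t = g t"
  shows "g \<in> borel_measurable (time_measure T)"
proof (rule measurableI)
  fix A :: "real set" assume "A \<in> sets borel"
  have N_leb: "N \<in> null_sets lebesgue"
    using N by (simp add: null_sets_restrict_space)
  have N_sets: "N \<in> sets (time_measure T)"
    using N by auto
  have "g -` A \<inter> {0<..<T} \<inter> N \<in> sets lebesgue"
    by (rule null_setsD2[OF null_sets_completion_subset[OF _ N_leb]]) auto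
  then have "g -` A \<inter> {0<..<T} \<inter> N \<in> sets (time_measure T)"
    by (subst sets_restrict_space_iff) auto
  moreover have "f -` A \<inter> space (time_measure T) - N \<in> sets (time_measure T)"
    using measurable_sets[OF f \<open>A \<in> sets borel\<close>] N_sets by (rule sets.Diff)
  ultimately have "(f -` A \<inter> space (time_measure T) - N) \<union> (g -` A \<inter> {0<..<T} \<inter> N) \<in> sets (time_measure T)"
    by (rule sets.Un[rotated])
  also have "(f -` A \<inter> space (time_measure T) - N) \<union> (g -` A \<inter> {0<..<T} \<inter> N) = g -` A \<inter> space (time_measure T)"
    using eq by auto
  finally show "g -` A \<inter> space (time_measure T) \<in> sets (time_measure T)" .
qed simp

text \<open>Measurability of \<open>a\<close> in t is given only for fixed arguments. Simple
  functions take finitely many pairs of values, which reduces them to that case; general arguments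
  are pointwise limits, and continuity of the bounded bilinear \<open>a t\<close> passes to the
  limit.\<close>

lemma borel_measurable_form:
  fixes a :: "real \<Rightarrow> 'v::{real_inner, second_countable_topology} \<Rightarrow> 'v \<Rightarrow> real"
  assumes a: "admissible_form T a"
    and u: "u \<in> borel_measurable (time_measure T)" and v: "v \<in> borel_measurable (time_measure T)"
  shows "(\<lambda>t. a t (u t) (v t)) \<in> borel_measurable (time_measure T)"
proof -
  let ?M = "time_measure T"
  obtain C where "AE t in ?M. bilinear (a t)" "AE t in ?M. \<forall>\<eta> \<zeta>. \<bar>a t \<eta> \<zeta>\<bar> \<le> C * norm \<eta> * norm \<zeta>"
    using a by (auto simp: admissible_form_def)
  then have "AE t in ?M. bounded_bilinear (a t)"
    by eventually_elim (rule bounded_bilinear_if_bilinear, auto)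
  then obtain N where N: "N \<in> null_sets ?M" "{t \<in> space ?M. \<not> bounded_bilinear (a t)} \<subseteq> N"
    by (auto simp: eventually_ae_filter)
  have N_sets: "N \<in> sets ?M"
    using N(1) by auto
  from borel_measurable_implies_sequence_metric[OF u, of 0] obtain s where
    s: "\<And>i. simple_function ?M (s i)" "\<And>t. t \<in> space ?M \<Longrightarrow> (\<lambda>i. s i t) \<longlonglongrightarrow> u t"
    by blast
  from borel_measurable_implies_sequence_metric[OF v, of 0] obtain r where
    r: "\<And>i. simple_function ?M (r i)" "\<And>t. t \<in> space ?M \<Longrightarrow> (\<lambda>i. r i t) \<longlonglongrightarrow> v t"
    by blast
  have simple: "(\<lambda>t. a t (s i t) (r i t)) \<in> borel_measurable ?M" for i
  proof -
    define p where "p t = (s i t, r i t)" for t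
    have p: "simple_function ?M p"
      unfolding p_def[abs_def] by (rule simple_function_Pair[OF s(1) r(1)])
    have "(\<lambda>t. (\<lambda>(\<eta>, \<zeta>) t. a t \<eta> \<zeta>) (p t) t) \<in> borel_measurable ?M"
    proof (rule measurable_compose_countable'[where I = "p ` space ?M"])
      show "p \<in> measurable ?M (count_space (p ` space ?M))"
        using p by (simp add: measurable_count_space_eq2 simple_function_def)
      show "countable (p ` space ?M)"
        using p by (simp add: simple_function_def countable_finite)
      show "(\<lambda>(\<eta>, \<zeta>) t. a t \<eta> \<zeta>) x \<in> borel_measurable ?M" for x
        using a by (cases x) (simp add: admissible_form_def)
    qed
    then show ?thesis
      by (simp add: p_def)
  qed
  \<comment> \<open>On N the form \<open>a t\<close> may fail to be continuous, so it is cut off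
    there to obtain convergence at every t; the values on N are restored afterwards.\<close>
  have "(\<lambda>t. indicator (- N) t * a t (u t) (v t)) \<in> borel_measurable ?M"
  proof (rule borel_measurable_LIMSEQ_real)
    show "(\<lambda>t. indicator (- N) t * a t (s i t) (r i t)) \<in> borel_measurable ?M" for i
      using borel_measurable_times[OF borel_measurable_indicator[OF sets.Diff[OF sets.top N_sets]] simple[of i]]
      by (rule measurable_cong[THEN iffD1, rotated]) (auto simp: indicator_def)
    fix t assume t: "t \<in> space ?M"
    show "(\<lambda>i. indicator (- N) t * a t (s i t) (r i t)) \<longlonglongrightarrow> indicator (- N) t * a t (u t) (v t)"
    proof (cases "t \<in> N")
      case False
      then have "bounded_bilinear (a t)"
        using t N(2) by auto
      from bounded_bilinear.tendsto[OF this s(2)[OF t] r(2)[OF t]] show ?thesis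
        by (rule tendsto_mult[OF tendsto_const])
    qed simp
  qed
  then show ?thesis
    by (rule borel_measurable_time_measure_cong_AE[OF _ N(1)]) auto
qed

lemma admissible_form_bounds:
  fixes a :: "real \<Rightarrow> 'v::{real_inner, second_countable_topology} \<Rightarrow> 'v \<Rightarrow> real"
  assumes "admissible_form T a"
  obtains C c where "0 \<le> C" "0 < c" "AE t in time_measure T. bilinear (a t)"
    "AE t in time_measure T. \<forall>\<eta> \<zeta>. \<bar>a t \<eta> \<zeta>\<bar> \<le> C * (norm \<eta> * norm \<zeta>)"
    "AE t in time_measure T. \<forall>\<eta>. c * (norm \<eta>)\<^sup>2 \<le> a t \<eta> \<eta>"
proof -
  obtain C c where C: "AE t in time_measure T. \<forall>\<eta> \<zeta>. \<bar>a t \<eta> \<zeta>\<bar> \<le> C * norm \<eta> * norm \<zeta>"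
    and c: "0 < c" "AE t in time_measure T. \<forall>\<eta>. c * (norm \<eta>)\<^sup>2 \<le> a t \<eta> \<eta>"
    and bil: "AE t in time_measure T. bilinear (a t)"
    using assms unfolding admissible_form_def by blast
  \<comment> \<open>The constant in \<open>admissible_form\<close> carries no sign, while the
    integral estimates multiply by it.\<close>
  have "AE t in time_measure T. \<forall>\<eta> \<zeta>. \<bar>a t \<eta> \<zeta>\<bar> \<le> max C 0 * (norm \<eta> * norm \<zeta>)"
    using C
  proof eventually_elim
    case (elim t)
    show ?case
    proof (intro allI)
      fix \<eta> \<zeta>
      have "\<bar>a t \<eta> \<zeta>\<bar> \<le> C * (norm \<eta> * norm \<zeta>)"
        using elim by (simp add: mult.assoc)
      also have "\<dots> \<le> max C 0 * (norm \<eta> * norm \<zeta>)"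
        by (intro mult_right_mono) auto
      finally show "\<bar>a t \<eta> \<zeta>\<bar> \<le> max C 0 * (norm \<eta> * norm \<zeta>)" .
    qed
  qed
  then show thesis
    using c bil by (intro that[of "max C 0" c]) auto
qed

context
  fixes T :: real and a :: "real \<Rightarrow> 'v::{real_inner, banach, second_countable_topology} \<Rightarrow> 'v \<Rightarrow> real"
  assumes a: "admissible_form T a"
begin

lemma
  shows integrable_form: "u \<in> Yspace T \<Longrightarrow> v \<in> Yspace T \<Longrightarrow> integrable (time_measure T) (\<lambda>t. a t (u t) (v t))"
    and form_integral_bound: "\<exists>C\<ge>0. \<forall>u\<in>Yspace T. \<forall>v\<in>Yspace T.
      \<bar>LINT t|time_measure T. a t (u t) (v t)\<bar> \<le> C * (L2_norm T u * L2_norm T v)"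
proof -
  obtain C c where C: "0 \<le> C" and "0 < c" "AE t in time_measure T. bilinear (a t)"
    and C_bound: "AE t in time_measure T. \<forall>\<eta> \<zeta>. \<bar>a t \<eta> \<zeta>\<bar> \<le> C * (norm \<eta> * norm \<zeta>)"
    and "AE t in time_measure T. \<forall>\<eta>. c * (norm \<eta>)\<^sup>2 \<le> a t \<eta> \<eta>"
    by (rule admissible_form_bounds[OF a])
  have *: "integrable (time_measure T) (\<lambda>t. a t (u t) (v t)) \<and>
      \<bar>LINT t|time_measure T. a t (u t) (v t)\<bar> \<le> C * (L2_norm T u * L2_norm T v)"
    if "u \<in> Yspace T" "v \<in> Yspace T" for u v
  proof (rule L2_bilinear_bound[OF _ _ borel_measurable_form[OF a] C])
    show "AE t in time_measure T. \<bar>a t (u t) (v t)\<bar> \<le> C * (norm (u t) * norm (v t))"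
      using C_bound by eventually_elim blast
  qed (use that in \<open>auto simp: Yspace_def L2_def\<close>)
  show "u \<in> Yspace T \<Longrightarrow> v \<in> Yspace T \<Longrightarrow> integrable (time_measure T) (\<lambda>t. a t (u t) (v t))"
    using * by blast
  show "\<exists>C\<ge>0. \<forall>u\<in>Yspace T. \<forall>v\<in>Yspace T.
      \<bar>LINT t|time_measure T. a t (u t) (v t)\<bar> \<le> C * (L2_norm T u * L2_norm T v)"
    using * C by blast
qed

lemma AE_bilinear: "AE t in time_measure T. bilinear (a t)"
  using a by (simp add: admissible_form_def)

lemma Aop_diff:
  assumes "u \<in> Yspace T" "w \<in> Yspace T" "v \<in> Yspace T"
  shows "Aop T a (\<lambda>t. u t - w t) v = Aop T a u v - Aop T a w v"
proof -
  have "(\<lambda>t. u t - w t) \<in> Yspace T"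
    using assms by (simp add: Yspace_def L2_diff)
  note int = integrable_form[OF this assms(3)] integrable_form[OF assms(1,3)] integrable_form[OF assms(2,3)]
  have "(LINT t|time_measure T. a t (u t - w t) (v t)) = (LINT t|time_measure T. a t (u t) (v t) - a t (w t) (v t))"
    by (rule integral_cong_AE) (use int AE_bilinear in \<open>auto elim!: eventually_mono simp: bilinear_lsub\<close>)
  then show ?thesis
    using int assms by (simp add: Aop_def)
qed

lemma Aop_add:
  assumes "w \<in> Yspace T" "u \<in> Yspace T" "v \<in> Yspace T"
  shows "Aop T a w (\<lambda>t. u t + v t) = Aop T a w u + Aop T a w v"
proof -
  have uv: "(\<lambda>t. u t + v t) \<in> Yspace T"
    using assms by (simp add: Yspace_def L2_add)
  note int = integrable_form[OF assms(1) uv] integrable_form[OF assms(1,2)] integrable_form[OF assms(1,3)]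
  have "(LINT t|time_measure T. a t (w t) (u t + v t)) = (LINT t|time_measure T. a t (w t) (u t) + a t (w t) (v t))"
    by (rule integral_cong_AE) (use int AE_bilinear in \<open>auto elim!: eventually_mono simp: bilinear_radd\<close>)
  then show ?thesis
    using int assms uv by (simp add: Aop_def)
qed

lemma Aop_scaleR:
  assumes "w \<in> Yspace T" "v \<in> Yspace T"
  shows "Aop T a w (\<lambda>t. s *\<^sub>R v t) = s * Aop T a w v"
proof -
  have sv: "(\<lambda>t. s *\<^sub>R v t) \<in> Yspace T"
    using assms by (simp add: Yspace_def L2_scaleR)
  note int = integrable_form[OF assms(1) sv] integrable_form[OF assms]
  have "(LINT t|time_measure T. a t (w t) (s *\<^sub>R v t)) = (LINT t|time_measure T. s * a t (w t) (v t))"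
    by (rule integral_cong_AE) (use int AE_bilinear in \<open>auto elim!: eventually_mono simp: bilinear_rmul\<close>)
  then show ?thesis
    using int assms sv by (simp add: Aop_def)
qed

text \<open>A and its adjoint agree on the diagonal, so the norm of Y is governed by
  \<open>a t (v t) (v t)\<close>, where coercivity applies directly.\<close>

lemma Asym_self: "v \<in> Yspace T \<Longrightarrow> Asym T a v v = (LINT t|time_measure T. a t (v t) (v t))"
  by (simp add: Asym_def Aop_adj_def Aop_def)

lemma L2_norm_le_Asym: "\<exists>c>0. \<forall>v\<in>Yspace T. c * (L2_norm T v)\<^sup>2 \<le> Asym T a v v"
proof -
  obtain C c where "0 \<le> C" and c: "0 < c" and "AE t in time_measure T. bilinear (a t)"
    "AE t in time_measure T. \<forall>\<eta> \<zeta>. \<bar>a t \<eta> \<zeta>\<bar> \<le> C * (norm \<eta> * norm \<zeta>)"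
    and coercive: "AE t in time_measure T. \<forall>\<eta>. c * (norm \<eta>)\<^sup>2 \<le> a t \<eta> \<eta>"
    by (rule admissible_form_bounds[OF a])
  have "c * (L2_norm T v)\<^sup>2 \<le> Asym T a v v" if v: "v \<in> Yspace T" for v
  proof -
    have sq: "integrable (time_measure T) (\<lambda>t. (norm (v t))\<^sup>2)"
      using v by (simp add: Yspace_def L2_def)
    have "c * (L2_norm T v)\<^sup>2 = (LINT t|time_measure T. c * (norm (v t))\<^sup>2)"
      by (simp add: L2_norm_def integral_nonneg_AE)
    also have "\<dots> \<le> (LINT t|time_measure T. a t (v t) (v t))"
      by (rule integral_mono_AE) (use sq coercive integrable_form[OF v v] in \<open>auto elim!: eventually_mono\<close>)
    finally show ?thesis
      by (simp add: Asym_self[OF v])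
  qed
  with c show ?thesis
    by blast
qed

lemma Asym_nonneg: "v \<in> Yspace T \<Longrightarrow> 0 \<le> Asym T a v v"
  using L2_norm_le_Asym by (meson less_imp_le mult_nonneg_nonneg order_trans zero_le_power2)

lemma Ynorm_power2: "v \<in> Yspace T \<Longrightarrow> (Ynorm T a v)\<^sup>2 = Asym T a v v"
  by (simp add: Ynorm_def Asym_nonneg)

lemma L2_norm_le_Ynorm: "\<exists>k\<ge>0. \<forall>v\<in>Yspace T. L2_norm T v \<le> k * Ynorm T a v"
proof -
  obtain c where c: "0 < c" "\<And>v. v \<in> Yspace T \<Longrightarrow> c * (L2_norm T v)\<^sup>2 \<le> Asym T a v v"
    using L2_norm_le_Asym by blast
  have "L2_norm T v \<le> (1 / sqrt c) * Ynorm T a v" if "v \<in> Yspace T" for v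
    using real_sqrt_le_mono[OF c(2)[OF that]] c(1)
    by (simp add: Ynorm_def real_sqrt_mult field_simps)
  with c(1) show ?thesis
    by (intro exI[of _ "1 / sqrt c"]) simp
qed

lemma Ynorm_scaleR:
  assumes v: "v \<in> Yspace T"
  shows "Ynorm T a (\<lambda>t. s *\<^sub>R v t) = \<bar>s\<bar> * Ynorm T a v"
proof -
  have sv: "(\<lambda>t. s *\<^sub>R v t) \<in> Yspace T"
    using v by (simp add: Yspace_def L2_scaleR)
  have "(LINT t|time_measure T. a t (s *\<^sub>R v t) (s *\<^sub>R v t)) = (LINT t|time_measure T. s\<^sup>2 * a t (v t) (v t))"
    by (rule integral_cong_AE)
       (use integrable_form[OF v v] integrable_form[OF sv sv] AE_bilinear in
         \<open>auto elim!: eventually_mono simp: bilinear_rmul bilinear_lmul power2_eq_square\<close>)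
  then show ?thesis
    by (simp add: Ynorm_def Asym_self[OF v] Asym_self[OF sv] real_sqrt_mult)
qed

lemma Ynorm_cong_AE:
  assumes "u \<in> Yspace T" "v \<in> Yspace T" "AE t in time_measure T. u t = v t"
  shows "Ynorm T a u = Ynorm T a v"
proof -
  have "(LINT t|time_measure T. a t (u t) (u t)) = (LINT t|time_measure T. a t (v t) (v t))"
    by (rule integral_cong_AE)
       (use integrable_form[OF assms(1,1)] integrable_form[OF assms(2,2)] assms(3) in \<open>auto elim!: eventually_mono\<close>)
  then show ?thesis
    by (simp add: Ynorm_def Asym_self assms)
qed

text \<open>Both parts of B are bounded by the L2 norm of v, and coercivity converts this into the
  energy norm of Y. Membership in the dual is what makes the supremum in the dual norm a finite
  bound.\<close>

lemma Bop_in_Ydual: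
  fixes j :: "'v \<Rightarrow> 'h::real_inner"
  assumes z: "z \<in> Xspace T j"
  shows "Bop T j a z \<in> Ydual T a"
proof -
  define F where "F = weak_deriv T (\<lambda>s. H_to_dual j (j (z s)))"
  have F: "F \<in> L2 T"
    using z by (auto simp: F_def Xspace_def intro: weak_deriv_if_H1)
  have zY: "z \<in> Yspace T"
    using z by (simp add: Xspace_def Yspace_def)
  have B: "Bop T j a z v = (LINT t|time_measure T. blinfun_apply (F t) (v t)) + Aop T a z v" if "v \<in> Yspace T" for v
    using that by (simp add: Bop_def dt_op_def F_def)
  have int: "integrable (time_measure T) (\<lambda>t. blinfun_apply (F t) (v t))" if "v \<in> Yspace T" for v
    using that by (intro integrable_dual_pairing F) (simp add: Yspace_def)
  obtain k where k: "0 \<le> k" "\<And>v. v \<in> Yspace T \<Longrightarrow> L2_norm T v \<le> k * Ynorm T a v"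
    using L2_norm_le_Ynorm by blast
  obtain C where C: "0 \<le> C" "\<And>u v. u \<in> Yspace T \<Longrightarrow> v \<in> Yspace T \<Longrightarrow>
      \<bar>LINT t|time_measure T. a t (u t) (v t)\<bar> \<le> C * (L2_norm T u * L2_norm T v)"
    using form_integral_bound by blast
  have bound: "\<bar>Bop T j a z v\<bar> \<le> (L2_norm T F + C * L2_norm T z) * k * Ynorm T a v" if v: "v \<in> Yspace T" for v
  proof -
    have "\<bar>Bop T j a z v\<bar> \<le> \<bar>LINT t|time_measure T. blinfun_apply (F t) (v t)\<bar> + \<bar>LINT t|time_measure T. a t (z t) (v t)\<bar>"
      using v by (simp add: B Aop_def abs_triangle_ineq)
    also have "\<dots> \<le> L2_norm T F * L2_norm T v + C * (L2_norm T z * L2_norm T v)"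
      using v by (intro add_mono dual_pairing_bound C F zY) (simp_all add: Yspace_def)
    also have "\<dots> = (L2_norm T F + C * L2_norm T z) * L2_norm T v"
      by (simp add: algebra_simps)
    also have "\<dots> \<le> (L2_norm T F + C * L2_norm T z) * (k * Ynorm T a v)"
      using C(1) k(2)[OF v] by (intro mult_left_mono) auto
    finally show ?thesis
      by (simp add: mult.assoc)
  qed
  show ?thesis
    unfolding dual_space_def
  proof (intro CollectI conjI ballI allI)
    show "Bop T j a z \<in> extensional (Yspace T)"
      by (simp add: Bop_def)
    show "\<exists>C. \<forall>v\<in>Yspace T. \<bar>Bop T j a z v\<bar> \<le> C * Ynorm T a v"
      using bound by blast
  next
    fix u v :: "real \<Rightarrow> 'v" assume uv: "u \<in> Yspace T" "v \<in> Yspace T"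
    then have "(\<lambda>t. u t + v t) \<in> Yspace T"
      by (simp add: Yspace_def L2_add)
    then show "Bop T j a z (\<lambda>t. u t + v t) = Bop T j a z u + Bop T j a z v"
      using uv int by (simp add: B Aop_add[OF zY] blinfun.add_right)
  next
    fix s and v :: "real \<Rightarrow> 'v" assume v: "v \<in> Yspace T"
    then have "(\<lambda>t. s *\<^sub>R v t) \<in> Yspace T"
      by (simp add: Yspace_def L2_scaleR)
    then show "Bop T j a z (\<lambda>t. s *\<^sub>R v t) = s * Bop T j a z v"
      using v int by (simp add: B Aop_scaleR[OF zY] blinfun.scaleR_right algebra_simps)
  qed
qed

lemma Bop_diff:
  fixes j :: "'v \<Rightarrow> 'h::real_inner"
  assumes "0 < T" "bounded_linear j" "u \<in> Xspace T j" "w \<in> Xspace T j"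
  shows "Bop T j a (\<lambda>t. u t - w t) = functional_diff (Yspace T) (Bop T j a u) (Bop T j a w)"
proof -
  have "u \<in> Yspace T" "w \<in> Yspace T"
    using assms by (auto simp: Xspace_def Yspace_def)
  then show ?thesis
    by (auto simp: Bop_def functional_diff_def dt_op_diff[OF assms] Aop_diff restrict_def fun_eq_iff)
qed

end

subsection \<open>Functionals on seminormed function spaces\<close>

text \<open>An abstract n serves Y and each Y_delta alike. Homogeneity permits scaling into the unit
  ball, and invariance under a.e. equality accommodates operators that are linear only up to null
  sets.\<close>

locale ae_seminormed =
  fixes T :: real and S :: "(real \<Rightarrow> 'v::real_vector) set" and n :: "(real \<Rightarrow> 'v) \<Rightarrow> real"
  assumes zero_mem: "(\<lambda>t. 0) \<in> S"
    and add_mem: "u \<in> S \<Longrightarrow> v \<in> S \<Longrightarrow> (\<lambda>t. u t + v t) \<in> S"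
    and scale_mem: "v \<in> S \<Longrightarrow> (\<lambda>t. s *\<^sub>R v t) \<in> S"
    and n_nonneg: "v \<in> S \<Longrightarrow> 0 \<le> n v"
    and n_scale: "v \<in> S \<Longrightarrow> n (\<lambda>t. s *\<^sub>R v t) = \<bar>s\<bar> * n v"
    and n_cong_AE: "u \<in> S \<Longrightarrow> v \<in> S \<Longrightarrow> AE t in time_measure T. u t = v t \<Longrightarrow> n u = n v"
begin

lemma n_zero: "n (\<lambda>t. 0) = 0"
  using n_scale[OF zero_mem, of 0] by simp

lemma dual_spaceD:
  assumes "f \<in> dual_space S n"
  shows "f \<in> extensional S" "u \<in> S \<Longrightarrow> v \<in> S \<Longrightarrow> f (\<lambda>t. u t + v t) = f u + f v"
    "v \<in> S \<Longrightarrow> f (\<lambda>t. s *\<^sub>R v t) = s * f v"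
  using assms by (auto simp: dual_space_def)

lemma dual_spaceE:
  assumes "f \<in> dual_space S n"
  obtains C where "0 \<le> C" "\<And>v. v \<in> S \<Longrightarrow> \<bar>f v\<bar> \<le> C * n v"
proof -
  obtain C where C: "\<And>v. v \<in> S \<Longrightarrow> \<bar>f v\<bar> \<le> C * n v"
    using assms unfolding dual_space_def by blast
  have "\<bar>f v\<bar> \<le> \<bar>C\<bar> * n v" if "v \<in> S" for v
    using C[OF that] mult_right_mono[OF abs_ge_self n_nonneg[OF that], of C] by linarith
  then show thesis
    by (intro that[of "\<bar>C\<bar>"]) auto
qed

text \<open>The difference has seminorm 0, so boundedness makes the functional vanish on it. It is
  written as u + (-1) v because the axioms speak of sums and multiples.\<close>

lemma dual_cong_AE:
  assumes f: "f \<in> dual_space S n" and "u \<in> S" "v \<in> S" and eq: "AE t in time_measure T. u t = v t"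
  shows "f u = f v"
proof -
  let ?d = "\<lambda>t. u t + (-1) *\<^sub>R v t"
  have mv: "(\<lambda>t. (-1) *\<^sub>R v t) \<in> S" and d: "?d \<in> S"
    by (intro add_mem scale_mem assms)+
  have "n ?d = n (\<lambda>t. 0)"
    by (rule n_cong_AE[OF d zero_mem]) (use eq in \<open>auto elim!: eventually_mono\<close>)
  moreover obtain C where "\<bar>f ?d\<bar> \<le> C * n ?d"
    using dual_spaceE[OF f] d by metis
  ultimately have "f ?d = 0"
    using n_zero by simp
  moreover have "f ?d = f u + (-1) * f v"
    using dual_spaceD(2)[OF f assms(2) mv] dual_spaceD(3)[OF f assms(3), of "-1"] by simp
  ultimately show ?thesis
    by simp
qed

lemma unit_ball_nonempty: "{v \<in> S. n v \<le> 1} \<noteq> {}"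
  using zero_mem n_zero by force

lemma bdd_above_unit_ball:
  assumes "\<And>v. v \<in> S \<Longrightarrow> h v \<le> C * n v"
  shows "bdd_above (h ` {v \<in> S. n v \<le> 1})"
proof (rule bdd_aboveI2)
  fix v assume v: "v \<in> {v \<in> S. n v \<le> 1}"
  then have "C * n v \<le> \<bar>C\<bar> * n v" "\<bar>C\<bar> * n v \<le> \<bar>C\<bar> * 1"
    using n_nonneg by (blast intro: mult_right_mono abs_ge_self, intro mult_left_mono) auto
  then show "h v \<le> \<bar>C\<bar>"
    using assms[of v] v by simp
qed

lemma dual_norm_le:
  assumes "0 \<le> C" "\<And>v. v \<in> S \<Longrightarrow> \<bar>f v\<bar> \<le> C * n v"
  shows "dual_norm S n f \<le> C"
  unfolding dual_norm_def
proof (rule cSUP_least[OF unit_ball_nonempty])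
  fix v assume v: "v \<in> {v \<in> S. n v \<le> 1}"
  then have "C * n v \<le> C * 1"
    using assms(1) by (intro mult_left_mono) auto
  then show "\<bar>f v\<bar> \<le> C"
    using assms(2)[of v] v by simp
qed

lemma normalized:
  assumes "v \<in> S" "n v \<noteq> 0"
  shows "(\<lambda>t. (1 / n v) *\<^sub>R v t) \<in> {v \<in> S. n v \<le> 1}"
  using assms n_nonneg[OF assms(1)] by (simp add: n_scale scale_mem)

text \<open>Scale v to the unit sphere. A nonzero v may have n v = 0 and cannot be scaled; there
  boundedness alone gives f v = 0.\<close>

lemma dual_bound:
  assumes f: "f \<in> dual_space S n" and v: "v \<in> S"
  shows "\<bar>f v\<bar> \<le> dual_norm S n f * n v"
proof -
  obtain C where C: "0 \<le> C" "\<And>v. v \<in> S \<Longrightarrow> \<bar>f v\<bar> \<le> C * n v"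
    using dual_spaceE[OF f] by blast
  show ?thesis
  proof (cases "n v = 0")
    case True
    then show ?thesis
      using C(2)[OF v] by simp
  next
    case False
    then have pos: "0 < n v"
      using n_nonneg[OF v] by simp
    note bdd = bdd_above_unit_ball[of "\<lambda>v. \<bar>f v\<bar>", OF C(2)]
    from cSUP_upper[OF normalized[OF v False] bdd]
    have "\<bar>f (\<lambda>t. (1 / n v) *\<^sub>R v t)\<bar> \<le> dual_norm S n f"
      by (simp add: dual_norm_def)
    then show ?thesis
      using pos by (simp add: dual_spaceD(3)[OF f v, of "1 / n v", simplified] field_simps)
  qed
qed

lemma dual_norm_nonneg: "f \<in> dual_space S n \<Longrightarrow> 0 \<le> dual_norm S n f"
proof -
  assume f: "f \<in> dual_space S n"
  obtain C where C: "0 \<le> C" "\<And>v. v \<in> S \<Longrightarrow> \<bar>f v\<bar> \<le> C * n v"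
    using dual_spaceE[OF f] by blast
  note bdd = bdd_above_unit_ball[of "\<lambda>v. \<bar>f v\<bar>", OF C(2)]
  from cSUP_upper2[OF bdd, of "\<lambda>t. 0" 0] show "0 \<le> dual_norm S n f"
    using zero_mem n_zero by (simp add: dual_norm_def)
qed

lemma operator_norm_bound:
  assumes Q: "bounded_operator T S n Q" and v: "v \<in> S"
  shows "n (Q v) \<le> operator_norm S n Q * n v"
proof -
  obtain C where C: "\<And>v. v \<in> S \<Longrightarrow> n (Q v) \<le> C * n v"
    using Q unfolding bounded_operator_def by blast
  have QS: "Q v \<in> S" if "v \<in> S" for v
    using Q that by (auto simp: bounded_operator_def)
  show ?thesis
  proof (cases "n v = 0")
    case True
    then show ?thesis
      using C[OF v] by simp
  next
    case False
    then have pos: "0 < n v"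
      using n_nonneg[OF v] by simp
    let ?w = "\<lambda>t. (1 / n v) *\<^sub>R v t"
    note bdd = bdd_above_unit_ball[of "\<lambda>v. n (Q v)", OF C]
    from cSUP_upper[OF normalized[OF v False] bdd]
    have le: "n (Q ?w) \<le> operator_norm S n Q"
      by (simp add: operator_norm_def)
    \<comment> \<open>Q is homogeneous only almost everywhere, which the seminorm does not
      notice.\<close>
    have "n (Q ?w) = n (\<lambda>t. (1 / n v) *\<^sub>R Q v t)"
    proof (rule n_cong_AE)
      show "AE t in time_measure T. Q ?w t = (1 / n v) *\<^sub>R Q v t"
        using Q v by (simp add: bounded_operator_def)
    qed (use QS v in \<open>auto intro!: scale_mem\<close>)
    also have "\<dots> = n (Q v) / n v"
      using pos by (simp add: n_scale[OF QS[OF v]])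
    finally have "n (Q v) / n v \<le> operator_norm S n Q"
      using le by simp
    then show ?thesis
      by (simp add: pos_divide_le_eq[OF pos])
  qed
qed

lemma operator_norm_nonneg:
  assumes Q: "bounded_operator T S n Q"
  shows "0 \<le> operator_norm S n Q"
proof -
  obtain C where C: "\<And>v. v \<in> S \<Longrightarrow> n (Q v) \<le> C * n v"
    using Q unfolding bounded_operator_def by blast
  note bdd = bdd_above_unit_ball[of "\<lambda>v. n (Q v)", OF C]
  have "Q (\<lambda>t. 0) \<in> S"
    using Q zero_mem by (auto simp: bounded_operator_def)
  then show ?thesis
    using cSUP_upper2[OF bdd, of "\<lambda>t. 0" 0] zero_mem n_zero n_nonneg
    by (simp add: operator_norm_def)
qed

text \<open>Applied to g, this puts the oscillation functional into Y', so that its dual norm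
  controls its values. Linearity of f after Q is exact since f ignores null sets.\<close>

lemma functional_diff_adjoint_mem:
  assumes Q: "bounded_operator T S n Q" and f: "f \<in> dual_space S n"
  shows "functional_diff S f (adjoint_op S Q f) \<in> dual_space S n"
proof -
  have QS: "Q v \<in> S" if "v \<in> S" for v
    using Q that by (auto simp: bounded_operator_def)
  have add: "f (Q (\<lambda>t. u t + v t)) = f (Q u) + f (Q v)" if "u \<in> S" "v \<in> S" for u v
  proof -
    have "f (Q (\<lambda>t. u t + v t)) = f (\<lambda>t. Q u t + Q v t)"
      using Q that by (intro dual_cong_AE[OF f] add_mem QS) (simp_all add: bounded_operator_def)
    then show ?thesis
      using dual_spaceD(2)[OF f] QS that by simp
  qed
  have scale: "f (Q (\<lambda>t. s *\<^sub>R v t)) = s * f (Q v)" if "v \<in> S" for s v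
  proof -
    have "f (Q (\<lambda>t. s *\<^sub>R v t)) = f (\<lambda>t. s *\<^sub>R Q v t)"
      using Q that by (intro dual_cong_AE[OF f] scale_mem QS) (simp_all add: bounded_operator_def)
    then show ?thesis
      using dual_spaceD(3)[OF f] QS that by simp
  qed
  obtain C where C: "0 \<le> C" "\<And>v. v \<in> S \<Longrightarrow> \<bar>f v\<bar> \<le> C * n v"
    using dual_spaceE[OF f] by blast
  have "\<bar>f v - f (Q v)\<bar> \<le> (C + C * operator_norm S n Q) * n v" if "v \<in> S" for v
  proof -
    have "C * n (Q v) \<le> C * (operator_norm S n Q * n v)"
      using C(1) operator_norm_bound[OF Q that] by (rule mult_left_mono[rotated])
    then show ?thesis
      using C(2)[OF that] C(2)[OF QS[OF that]] by (simp add: algebra_simps)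
  qed
  then have "\<exists>C. \<forall>v\<in>S. \<bar>f v - f (Q v)\<bar> \<le> C * n v"
    by blast
  then show ?thesis
    using dual_spaceD(2,3)[OF f] add scale
    by (simp add: dual_space_def functional_diff_def adjoint_op_def add_mem scale_mem algebra_simps)
qed

end

section \<open>The scalar product on the dual induced by the preconditioner\<close>

locale preconditioner = ae_seminormed T S n
  for T and S :: "(real \<Rightarrow> 'v::real_vector) set" and n +
  fixes K :: "((real \<Rightarrow> 'v) \<Rightarrow> real) \<Rightarrow> (real \<Rightarrow> 'v)" and r R :: real
  assumes invertible: "boundedly_invertible_dual_op T S n K"
    and symmetric: "symmetric_dual_op S n K"
    and r_pos: "0 < r"
    and equivalent: "v \<in> S \<Longrightarrow> r * (n v)\<^sup>2 \<le> dual_op_inverse T S n K v v \<and>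
      dual_op_inverse T S n K v v \<le> R * (n v)\<^sup>2"
begin

lemma K_mem: "f \<in> dual_space S n \<Longrightarrow> K f \<in> S"
  using invertible by (auto simp: boundedly_invertible_dual_op_def)

lemma dual_op_inverse:
  assumes "v \<in> S"
  shows "dual_op_inverse T S n K v \<in> dual_space S n"
    "AE t in time_measure T. K (dual_op_inverse T S n K v) t = v t"
proof -
  have "\<exists>!f. f \<in> dual_space S n \<and> (AE t in time_measure T. K f t = v t)"
    using invertible assms unfolding boundedly_invertible_dual_op_def by blast
  from theI'[OF this] show "dual_op_inverse T S n K v \<in> dual_space S n"
    "AE t in time_measure T. K (dual_op_inverse T S n K v) t = v t"
    unfolding dual_op_inverse_def by auto
qed

lemma dual_op_inverse_K:
  assumes f: "f \<in> dual_space S n"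
  shows "dual_op_inverse T S n K (K f) = f"
proof -
  have "\<exists>!h. h \<in> dual_space S n \<and> (AE t in time_measure T. K h t = K f t)"
    using invertible K_mem[OF f] unfolding boundedly_invertible_dual_op_def by blast
  from the1_equality[OF this] show ?thesis
    unfolding dual_op_inverse_def using f by simp
qed

lemma dual_combination:
  assumes f: "f \<in> dual_space S n" and h: "h \<in> dual_space S n"
  shows "(\<lambda>v\<in>S. s * h v) \<in> dual_space S n" "(\<lambda>v\<in>S. f v + h v) \<in> dual_space S n"
proof -
  obtain C where C: "\<And>v. v \<in> S \<Longrightarrow> \<bar>f v\<bar> \<le> C * n v"
    using dual_spaceE[OF f] by blast
  obtain D where D: "\<And>v. v \<in> S \<Longrightarrow> \<bar>h v\<bar> \<le> D * n v"
    using dual_spaceE[OF h] by blast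
  have "\<bar>s * h v\<bar> \<le> (\<bar>s\<bar> * D) * n v" if "v \<in> S" for v
    using mult_left_mono[OF D[OF that], of "\<bar>s\<bar>"] by (simp add: abs_mult mult.assoc)
  then have "\<exists>C. \<forall>v\<in>S. \<bar>s * h v\<bar> \<le> C * n v"
    by blast
  then show "(\<lambda>v\<in>S. s * h v) \<in> dual_space S n"
    using dual_spaceD[OF h] by (simp add: dual_space_def add_mem scale_mem algebra_simps)
  have "\<bar>f v + h v\<bar> \<le> (C + D) * n v" if "v \<in> S" for v
    using C[OF that] D[OF that] by (simp add: distrib_right)
  then have "\<exists>C. \<forall>v\<in>S. \<bar>f v + h v\<bar> \<le> C * n v"
    by blast
  then show "(\<lambda>v\<in>S. f v + h v) \<in> dual_space S n"
    using dual_spaceD[OF f] dual_spaceD[OF h]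
    by (simp add: dual_space_def add_mem scale_mem algebra_simps)
qed

text \<open>The lower equivalence at v = K f, where the inverse returns f itself.\<close>

lemma K_form_lower: "f \<in> dual_space S n \<Longrightarrow> r * (n (K f))\<^sup>2 \<le> f (K f)"
  using equivalent[OF K_mem] dual_op_inverse_K by fastforce

lemma K_form_nonneg: "f \<in> dual_space S n \<Longrightarrow> 0 \<le> f (K f)"
  using K_form_lower r_pos by (meson less_imp_le mult_nonneg_nonneg order_trans zero_le_power2)

lemma K_norm_power2: "f \<in> dual_space S n \<Longrightarrow> (K_norm K f)\<^sup>2 = f (K f)"
  by (simp add: K_norm_def K_form_nonneg)

text \<open>The form (f, h) -> f (K h) is nonnegative, and symmetry of \<open>K\<close> merges its
  two cross terms, so its value at f + s h is a quadratic polynomial in s. Applying a functional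
  removes the a.e. qualification from the linearity of \<open>K\<close>.\<close>

lemma K_form_Cauchy_Schwarz:
  assumes f: "f \<in> dual_space S n" and h: "h \<in> dual_space S n"
  shows "(f (K h))\<^sup>2 \<le> f (K f) * h (K h)"
proof (rule quadratic_nonneg_imp_discriminant)
  fix s :: real
  define sh where "sh = (\<lambda>v\<in>S. s * h v)"
  define g where "g = (\<lambda>v\<in>S. f v + sh v)"
  have sh: "sh \<in> dual_space S n"
    unfolding sh_def by (rule dual_combination(1)[OF f h])
  have g: "g \<in> dual_space S n"
    unfolding g_def by (rule dual_combination(2)[OF f sh])
  have K_g: "e (K g) = e (K f) + s * e (K h)" if e: "e \<in> dual_space S n" for e
  proof -
    have "AE t in time_measure T. K g t = K f t + K sh t"
      using invertible f sh unfolding boundedly_invertible_dual_op_def g_def by blast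
    moreover have "AE t in time_measure T. K sh t = s *\<^sub>R K h t"
      using invertible h unfolding boundedly_invertible_dual_op_def sh_def by blast
    ultimately have "AE t in time_measure T. K g t = K f t + s *\<^sub>R K h t"
      by eventually_elim simp
    then have "e (K g) = e (\<lambda>t. K f t + s *\<^sub>R K h t)"
      using f g h by (intro dual_cong_AE[OF e] add_mem scale_mem K_mem)
    also have "\<dots> = e (K f) + s * e (K h)"
      using dual_spaceD(2)[OF e K_mem[OF f] scale_mem[OF K_mem[OF h]]] dual_spaceD(3)[OF e K_mem[OF h]]
      by simp
    finally show ?thesis .
  qed
  have "0 \<le> g (K g)"
    by (rule K_form_nonneg[OF g])
  also have "\<dots> = f (K g) + s * h (K g)"
    using K_mem[OF g] by (simp add: g_def sh_def)
  also have "\<dots> = f (K f) + 2 * s * f (K h) + s\<^sup>2 * h (K h)"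
    using symmetric f h by (simp add: K_g symmetric_dual_op_def power2_eq_square algebra_simps)
  finally show "0 \<le> f (K f) + 2 * s * f (K h) + s\<^sup>2 * h (K h)" .
qed

text \<open>With h the preimage of z, f z is f (K h), and Cauchy-Schwarz bounds it by the K-norms of
  f and h. The squared K-norm of h is h z, at most R (n z)^2 by the upper equivalence.\<close>

lemma abs_le_K_norm:
  assumes f: "f \<in> dual_space S n" and z: "z \<in> S"
  shows "\<bar>f z\<bar> \<le> sqrt R * K_norm K f * n z"
proof -
  define h where "h = dual_op_inverse T S n K z"
  have h: "h \<in> dual_space S n" and AE: "AE t in time_measure T. K h t = z t"
    using dual_op_inverse[OF z] by (auto simp: h_def)
  have eq: "e (K h) = e z" if "e \<in> dual_space S n" for e
    by (rule dual_cong_AE[OF that K_mem[OF h] z AE])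
  have "(f z)\<^sup>2 \<le> f (K f) * h z"
    using K_form_Cauchy_Schwarz[OF f h] by (simp add: eq f h)
  also have "\<dots> \<le> f (K f) * (R * (n z)\<^sup>2)"
    using equivalent[OF z] K_form_nonneg[OF f] by (intro mult_left_mono) (simp_all add: h_def)
  finally have "sqrt ((f z)\<^sup>2) \<le> sqrt (f (K f) * (R * (n z)\<^sup>2))"
    by (rule real_sqrt_le_mono)
  then show ?thesis
    using n_nonneg[OF z] by (simp add: K_norm_def real_sqrt_mult mult_ac)
qed

text \<open>Test with v = K f: then f (K f) \<le> c n (K f), and the lower equivalence bounds r (n
  (K f))^2 by f (K f) again. Squaring the first and dividing by f (K f) leaves c^2, which is why the
  value 0 is treated apart.\<close>

lemma K_norm_le_bound:
  assumes f: "f \<in> dual_space S n" and "0 \<le> c" and bound: "\<And>v. v \<in> S \<Longrightarrow> \<bar>f v\<bar> \<le> c * n v"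
  shows "r * (K_norm K f)\<^sup>2 \<le> c\<^sup>2"
proof (cases "f (K f) = 0")
  case True
  then show ?thesis
    using K_norm_power2[OF f] by simp
next
  case False
  then have pos: "0 < f (K f)"
    using K_form_nonneg[OF f] by simp
  have "(f (K f))\<^sup>2 \<le> (c * n (K f))\<^sup>2"
    using bound[OF K_mem[OF f]] pos by (intro power_mono) auto
  then have "r * (f (K f))\<^sup>2 \<le> c\<^sup>2 * (r * (n (K f))\<^sup>2)"
    using mult_left_mono[of _ _ r] r_pos by (fastforce simp: power_mult_distrib mult_ac)
  also have "\<dots> \<le> c\<^sup>2 * f (K f)"
    using K_form_lower[OF f] by (intro mult_left_mono) auto
  finally have "(r * f (K f)) * f (K f) \<le> c\<^sup>2 * f (K f)"
    by (simp add: power2_eq_square mult.assoc)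
  then show ?thesis
    using pos by (simp add: K_norm_power2[OF f])
qed

end

subsection \<open>The energy norm estimate\<close>

lemma ae_seminormed_Yspace:
  fixes a :: "real \<Rightarrow> 'v::{real_inner, banach, second_countable_topology} \<Rightarrow> 'v \<Rightarrow> real"
  assumes "admissible_form T a"
  shows "ae_seminormed T (Yspace T) (Ynorm T a)"
proof
  show "0 \<le> Ynorm T a v" if "v \<in> Yspace T" for v
    by (simp add: Ynorm_def Asym_nonneg[OF assms that])
  show "Ynorm T a u = Ynorm T a v" if "u \<in> Yspace T" "v \<in> Yspace T" "AE t in time_measure T. u t = v t" for u v
    by (rule Ynorm_cong_AE[OF assms that])
qed (simp_all add: Ynorm_scaleR[OF assms], simp_all add: Yspace_def L2_zero L2_add L2_scaleR)

lemma (in ae_seminormed) ae_seminormed_subspace: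
  assumes "closed_subspace S n S'"
  shows "ae_seminormed T S' n"
proof
  have sub: "v \<in> S" if "v \<in> S'" for v
    using assms that by (auto simp: closed_subspace_def)
  show "n u = n v" if "u \<in> S'" "v \<in> S'" "AE t in time_measure T. u t = v t" for u v
    using that by (intro n_cong_AE sub)
  show "0 \<le> n v" "n (\<lambda>t. s *\<^sub>R v t) = \<bar>s\<bar> * n v" if "v \<in> S'" for s v
    using sub[OF that] by (rule n_nonneg, rule n_scale)
qed (use assms in \<open>simp_all add: closed_subspace_def\<close>)

lemma (in ae_seminormed) restrict_dual:
  assumes S': "closed_subspace S n S'" and f: "f \<in> dual_space S n"
  shows "restrict f S' \<in> dual_space S' n"
proof -
  interpret S': ae_seminormed T S' n
    by (rule ae_seminormed_subspace[OF S'])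
  have sub: "v \<in> S" if "v \<in> S'" for v
    using S' that by (auto simp: closed_subspace_def)
  then have "\<exists>C. \<forall>v\<in>S'. \<bar>f v\<bar> \<le> C * n v"
    using dual_spaceE[OF f] by metis
  then show ?thesis
    using dual_spaceD(2,3)[OF f] sub by (simp add: dual_space_def S'.add_mem S'.scale_mem)
qed

theorem mainTheorem6:
  fixes T :: real
    and j :: "'v::{real_inner, banach, second_countable_topology} \<Rightarrow>
              'h::{real_inner, banach, second_countable_topology}"
    and a :: "real \<Rightarrow> 'v \<Rightarrow> 'v \<Rightarrow> real"
    and \<gamma>0 :: "(real \<Rightarrow> 'v) \<Rightarrow> 'h"
    and \<Delta> :: "'d set"
    and Xd Yd :: "'d \<Rightarrow> (real \<Rightarrow> 'v) set"
    and K :: "'d \<Rightarrow> ((real \<Rightarrow> 'v) \<Rightarrow> real) \<Rightarrow> (real \<Rightarrow> 'v)"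
    and Q :: "'d \<Rightarrow> (real \<Rightarrow> 'v) \<Rightarrow> (real \<Rightarrow> 'v)"
    and r R \<beta> :: real
    and g :: "(real \<Rightarrow> 'v) \<Rightarrow> real"
    and u0 :: 'h
    and u :: "real \<Rightarrow> 'v"
  assumes "0 < T"
    and "gelfand_embedding j"
    and "admissible_form T a"
    and "trace_map T j \<gamma>0"
    and "0 < r" and "r \<le> R"
    and "\<And>\<delta>. \<delta> \<in> \<Delta> \<Longrightarrow> closed_subspace (Xspace T j) (Xnorm T j) (Xd \<delta>)"
    and "\<And>\<delta>. \<delta> \<in> \<Delta> \<Longrightarrow> nonzero_space T (Xd \<delta>)"
    and "\<And>\<delta>. \<delta> \<in> \<Delta> \<Longrightarrow> closed_subspace (Yspace T) (Ynorm T a) (Yd \<delta>)"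
    and "\<And>\<delta>. \<delta> \<in> \<Delta> \<Longrightarrow> nonzero_space T (Yd \<delta>)"
    and "\<And>\<delta>. \<delta> \<in> \<Delta> \<Longrightarrow> boundedly_invertible_dual_op T (Yd \<delta>) (Ynorm T a) (K \<delta>)"
    and "\<And>\<delta>. \<delta> \<in> \<Delta> \<Longrightarrow> symmetric_dual_op (Yd \<delta>) (Ynorm T a) (K \<delta>)"
    and "\<And>\<delta> v. \<delta> \<in> \<Delta> \<Longrightarrow> v \<in> Yd \<delta> \<Longrightarrow>
           r * Asym T a v v \<le> dual_op_inverse T (Yd \<delta>) (Ynorm T a) (K \<delta>) v v \<and>
           dual_op_inverse T (Yd \<delta>) (Ynorm T a) (K \<delta>) v v \<le> R * Asym T a v v"
    and "\<And>\<delta>. \<delta> \<in> \<Delta> \<Longrightarrow> bounded_operator T (Yspace T) (Ynorm T a) (Q \<delta>)"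
    and "\<And>\<delta>. \<delta> \<in> \<Delta> \<Longrightarrow> Q \<delta> ` Yspace T \<subseteq> Yd \<delta>"
    and "\<And>\<delta> z. \<delta> \<in> \<Delta> \<Longrightarrow> z \<in> Xd \<delta> \<Longrightarrow>
           functional_diff (Yspace T) (Bop T j a z) (adjoint_op (Yspace T) (Q \<delta>) (Bop T j a z))
           = (\<lambda>v\<in>Yspace T. 0)"
    and "1 \<le> \<beta>"
    and "g \<in> Ydual T a"
    and "u \<in> Xspace T j" and "Bop T j a u = g" and "\<gamma>0 u = u0"
  shows "\<forall>\<delta>\<in>\<Delta>. \<forall>w\<in>Xd \<delta>.
           r * (K_norm (K \<delta>) (restrict (functional_diff (Yspace T) g (Bop T j a w)) (Yd \<delta>)))\<^sup>2
             + \<beta> * (norm (u0 - \<gamma>0 w))\<^sup>2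
           \<le> (Xenergy_norm T j a \<gamma>0 \<beta> (\<lambda>t. u t - w t))\<^sup>2 \<and>
           (Xenergy_norm T j a \<gamma>0 \<beta> (\<lambda>t. u t - w t))\<^sup>2
           \<le> (operator_norm (Yspace T) (Ynorm T a) (Q \<delta>) * sqrt R *
                K_norm (K \<delta>) (restrict (functional_diff (Yspace T) g (Bop T j a w)) (Yd \<delta>))
              + osc_error T a (Q \<delta>) g)\<^sup>2
             + \<beta> * (norm (u0 - \<gamma>0 w))\<^sup>2"
proof (intro ballI)
  fix \<delta> w
  assume \<delta>: "\<delta> \<in> \<Delta>" and w: "w \<in> Xd \<delta>"
  note a = assms(3) and g = assms(18)
  interpret Y: ae_seminormed T "Yspace T" "Ynorm T a"
    by (rule ae_seminormed_Yspace[OF a])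
  have YdY: "v \<in> Yspace T" if "v \<in> Yd \<delta>" for v
    using assms(9)[OF \<delta>] that by (auto simp: closed_subspace_def)
  interpret Yd: ae_seminormed T "Yd \<delta>" "Ynorm T a"
    by (rule Y.ae_seminormed_subspace[OF assms(9)[OF \<delta>]])
  interpret P: preconditioner T "Yd \<delta>" "Ynorm T a" "K \<delta>" r R
    by unfold_locales (use assms(5) assms(11-13)[OF \<delta>] Ynorm_power2[OF a YdY] in auto)
  have j: "bounded_linear j"
    using assms(2) by (simp add: gelfand_embedding_def)
  have wX: "w \<in> Xspace T j" and mwX: "(\<lambda>t. (-1) *\<^sub>R w t) \<in> Xspace T j"
    using assms(7)[OF \<delta>] w unfolding closed_subspace_def by blast+
  note Q = assms(14)[OF \<delta>]

  define f where "f = functional_diff (Yspace T) g (Bop T j a w)"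
  have f_eq: "f = Bop T j a (\<lambda>t. u t - w t)"
    using Bop_diff[OF a assms(1) j assms(19) wX] assms(20) by (simp add: f_def)
  have f: "f \<in> Ydual T a"
    unfolding f_eq by (intro Bop_in_Ydual[OF a] Xspace_diff assms(1,19) j wX)
  define F where "F = restrict f (Yd \<delta>)"
  have F: "F \<in> dual_space (Yd \<delta>) (Ynorm T a)"
    unfolding F_def by (rule Y.restrict_dual[OF assms(9)[OF \<delta>] f])
  have F_apply: "F v = f v" if "v \<in> Yd \<delta>" for v
    using that by (simp add: F_def)

  have trace: "\<gamma>0 (\<lambda>t. u t - w t) = u0 - \<gamma>0 w"
  proof -
    \<comment> \<open>The trace is given as additive and homogeneous on X, so the difference becomes
      a sum; the multiple of w lies in X because X_delta is a subspace.\<close>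
    have "\<gamma>0 (\<lambda>t. u t + (-1) *\<^sub>R w t) = \<gamma>0 u + \<gamma>0 (\<lambda>t. (-1) *\<^sub>R w t)"
      by (rule assms(4)[unfolded trace_map_def, THEN conjunct1, rule_format, OF assms(19) mwX])
    also have "\<gamma>0 (\<lambda>t. (-1) *\<^sub>R w t) = (-1) *\<^sub>R \<gamma>0 w"
      by (rule assms(4)[unfolded trace_map_def, THEN conjunct2, THEN conjunct1, rule_format, OF wX])
    finally show ?thesis
      using assms(21) by simp
  qed
  have energy: "(Xenergy_norm T j a \<gamma>0 \<beta> (\<lambda>t. u t - w t))\<^sup>2 =
      (Ydual_norm T a f)\<^sup>2 + \<beta> * (norm (u0 - \<gamma>0 w))\<^sup>2"
    using assms(17) by (simp add: Xenergy_norm_def f_eq[symmetric] trace)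

  \<comment> \<open>The dual norm over all of Y bounds f on the smaller space Y_delta too, so it can
    serve as the constant c.\<close>
  have lower: "r * (K_norm (K \<delta>) F)\<^sup>2 \<le> (Ydual_norm T a f)\<^sup>2"
    by (rule P.K_norm_le_bound[OF F Y.dual_norm_nonneg[OF f]]) (simp add: F_apply Y.dual_bound[OF f] YdY)

  let ?q = "operator_norm (Yspace T) (Ynorm T a) (Q \<delta>)"
  let ?k = "sqrt R * K_norm (K \<delta>) F"
  have osc: "functional_diff (Yspace T) g (adjoint_op (Yspace T) (Q \<delta>) g) \<in> Ydual T a"
    by (rule Y.functional_diff_adjoint_mem[OF Q g])
  \<comment> \<open>The sign is needed to insert the operator norm bound for Q v under the factor
    \<open>?k\<close>.\<close>
  have k: "0 \<le> ?k"
    using P.K_form_nonneg[OF F] assms(5,6) by (simp add: K_norm_def)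
  have upper: "Ydual_norm T a f \<le> ?q * ?k + osc_error T a (Q \<delta>) g"
  proof (rule Y.dual_norm_le)
    show "0 \<le> ?q * ?k + osc_error T a (Q \<delta>) g"
      unfolding osc_error_def
      by (rule add_nonneg_nonneg[OF mult_nonneg_nonneg[OF Y.operator_norm_nonneg[OF Q] k] Y.dual_norm_nonneg[OF osc]])
    fix v :: "real \<Rightarrow> 'v" assume v: "v \<in> Yspace T"
    then have Qv: "Q \<delta> v \<in> Yd \<delta>"
      using assms(15)[OF \<delta>] by blast
    have "Bop T j a w v - Bop T j a w (Q \<delta> v) = 0"
      using fun_cong[OF assms(16)[OF \<delta> w], of v] v by (simp add: functional_diff_def adjoint_op_def)
    then have split: "f v = functional_diff (Yspace T) g (adjoint_op (Yspace T) (Q \<delta>) g) v + F (Q \<delta> v)"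
      using v YdY[OF Qv] by (simp add: F_apply[OF Qv] f_def functional_diff_def adjoint_op_def)
    \<comment> \<open>The oscillation is estimated by its dual norm on Y, and F by its K-norm on
      Y_delta, where Q v lies.\<close>
    have "\<bar>f v\<bar> \<le> osc_error T a (Q \<delta>) g * Ynorm T a v + ?k * Ynorm T a (Q \<delta> v)"
      unfolding split osc_error_def
      by (rule order_trans[OF abs_triangle_ineq add_mono[OF Y.dual_bound[OF osc v] P.abs_le_K_norm[OF F Qv]]])
    also have "\<dots> \<le> osc_error T a (Q \<delta>) g * Ynorm T a v + ?k * (?q * Ynorm T a v)"
      by (rule add_left_mono[OF mult_left_mono[OF Y.operator_norm_bound[OF Q v] k]])
    finally show "\<bar>f v\<bar> \<le> (?q * ?k + osc_error T a (Q \<delta>) g) * Ynorm T a v"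
      by (simp add: algebra_simps)
  qed
  have "(Ydual_norm T a f)\<^sup>2 \<le> (?q * ?k + osc_error T a (Q \<delta>) g)\<^sup>2"
    using upper Y.dual_norm_nonneg[OF f] by (rule power_mono)
  with lower show "r * (K_norm (K \<delta>) (restrict (functional_diff (Yspace T) g (Bop T j a w)) (Yd \<delta>)))\<^sup>2
             + \<beta> * (norm (u0 - \<gamma>0 w))\<^sup>2
           \<le> (Xenergy_norm T j a \<gamma>0 \<beta> (\<lambda>t. u t - w t))\<^sup>2 \<and>
           (Xenergy_norm T j a \<gamma>0 \<beta> (\<lambda>t. u t - w t))\<^sup>2
           \<le> (operator_norm (Yspace T) (Ynorm T a) (Q \<delta>) * sqrt R *
                K_norm (K \<delta>) (restrict (functional_diff (Yspace T) g (Bop T j a w)) (Yd \<delta>))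
              + osc_error T a (Q \<delta>) g)\<^sup>2
             + \<beta> * (norm (u0 - \<gamma>0 w))\<^sup>2"
    by (simp add: energy F_def f_def mult.assoc)
qed

end
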